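(* Let $(W,S)$ be a Coxeter system. If $\Gamma$ is a $W$-digraph and $\mathscr V(\Gamma)$ is finite, then the following hold. (i) The number of connected components of $\Gamma$ is equal to $\dim M(\Gamma)_{\mathrm{ind}}$. (ii) If $n(s,t)<\infty$ for all $s,t\in S$, then the number of acyclic connected components of $\Gamma$ is equal to $\dim M(\Gamma)_{\mathrm{sgn}}$.
   Context: Coxeter system: $W$ has presentation $\langle s\in S\mid (rs)^{n(r,s)}=e \text{ for } r,s\in S,\ n(r,s)<\infty\rangle$ with $n(s,s)=1$ and $1<n(r,s)=n(s,r)\le\infty$ for $r\ne s$; $\ell$ is the length function. Hecke algebra: $u$ is an indeterminate and $H$ is the $\mathbb Q(u)$-algebra with basis $\{T_w\mid w\in W\}$ satisfying, for $s\in S$, $T_sT_w=T_{sw}$ if $\ell(sw)>\ell(w)$ and $T_sT_w=u^2T_{sw}+(u^2-1)T_w$ if $\ell(sw)<\ell(w)$. An $S$-labeled digraph is a directed multigraph $\Gamma$ with vertex set $\mathscr V(\Gamma)$ and edge set $\mathscr E(\Gamma)$, in which every edge is either solid or dashed and is labeled by an element of $S$ (written $\alpha\xrightarrow{s}\beta$ if solid, $\alpha\overset{s}{\dashrightarrow}\beta$ if dashed), such that $\Gamma$ has no loops and, for each $s\in S$, every vertex occurs in exactly one edge labeled $s$. Let $M(\Gamma)$ be the $\mathbb Q(u)$-vector space with basis $\mathscr V(\Gamma)$. For $s\in S$ let $\tau_s$ be the linear operator on $M(\Gamma)$ with, for each vertex $\alpha$ (where $\beta$ is the other endpoint of the edge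 labeled $s$ at $\alpha$): $\tau_s(\alpha)=\beta$ if the edge is $\alpha\xrightarrow{s}\beta$; $\tau_s(\alpha)=(u^2-1)\alpha+u^2\beta$ if it is $\beta\xrightarrow{s}\alpha$; $\tau_s(\alpha)=u\alpha+(u+1)\beta$ if it is $\alpha\overset{s}{\dashrightarrow}\beta$; $\tau_s(\alpha)=(u^2-u-1)\alpha+(u^2-u)\beta$ if it is $\beta\overset{s}{\dashrightarrow}\alpha$. An $S$-labeled digraph $\Gamma$ is a $W$-digraph if $T_s\mapsto\tau_s$ ($s\in S$) extends to a homomorphism of $\mathbb Q(u)$-algebras from $H$ to the algebra of all linear operators on $M(\Gamma)$; then $M(\Gamma)$ is regarded as an $H$-module in this way. Ignoring types and labels of edges gives a directed multigraph: $\Gamma$ (or a component of it) is acyclic if it has no nonempty directed circuit; connected components are those of the underlying undirected multigraph. $\mathrm{ind}$ and $\mathrm{sgn}$ are the linear characters of $H$ with $\mathrm{ind}(T_w)=u^{2\ell(w)}$ and $\mathrm{sgn}(T_w)=(-1)^{\ell(w)}$ for $w\in W$. For a linear character $\lambda$ of $H$ and an $H$-module $M$, $M_\lambda=\{v\in M\mid hv=\lambda(h)v\text{ for all }h\in H\}$. Dimensions are over $\mathbb Q(u)$. *)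

theory Defs
  imports
    "HOL-Algebra.Generated_Groups"
    "HOL-Algebra.Ring"
    "HOL-Computational_Algebra.Polynomial"
    "HOL-Computational_Algebra.Fraction_Field"
    "HOL-Library.Poly_Mapping"
    "HOL-Library.Extended_Nat"
    "HOL-Library.FuncSet"
    "Graph_Theory.Digraph_Component"
begin

section \<open>Group presentations and Coxeter systems\<close>

text \<open>
  A word over \<open>X\<close> is a list of letters \<open>(x, b)\<close> with \<open>x \<in> X\<close>; the letter \<open>(x, True)\<close> stands
  for \<open>x\<close> and \<open>(x, False)\<close> for its formal inverse.  The relation \<open>pres_eq X R\<close> is equality in
  the quotient of the free group on \<open>X\<close> by the normal closure of the words in \<open>R\<close>.
\<close>

inductive pres_eq ::
  "'x set \<Rightarrow> ('x \<times> bool) list set \<Rightarrow> ('x \<times> bool) list \<Rightarrow> ('x \<times> bool) list \<Rightarrow> bool"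
  for X :: "'x set" and R :: "('x \<times> bool) list set"
where
  refl: "pres_eq X R p p"
| sym: "pres_eq X R p q \<Longrightarrow> pres_eq X R q p"
| trans: "pres_eq X R p q \<Longrightarrow> pres_eq X R q r \<Longrightarrow> pres_eq X R p r"
| cancel: "x \<in> X \<Longrightarrow> pres_eq X R (p @ [(x, b), (x, \<not> b)] @ q) (p @ q)"
| relator: "r \<in> R \<Longrightarrow> pres_eq X R (p @ r @ q) (p @ q)"

definition word_value :: "('g, 'm) monoid_scheme \<Rightarrow> ('g \<times> bool) list \<Rightarrow> 'g" where
  "word_value G p =
     foldr (\<lambda>(x, b) y. (if b then x else inv\<^bsub>G\<^esub> x) \<otimes>\<^bsub>G\<^esub> y) p \<one>\<^bsub>G\<^esub>"

definition has_presentation ::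
  "('g, 'm) monoid_scheme \<Rightarrow> 'g set \<Rightarrow> ('g \<times> bool) list set \<Rightarrow> bool"
where
  "has_presentation G X R \<longleftrightarrow>
     X \<subseteq> carrier G \<and> generate G X = carrier G \<and>
     (\<forall>p q. fst ` set p \<subseteq> X \<longrightarrow> fst ` set q \<subseteq> X \<longrightarrow>
        (word_value G p = word_value G q \<longleftrightarrow> pres_eq X R p q))"

definition coxeter_relators :: "'w set \<Rightarrow> ('w \<Rightarrow> 'w \<Rightarrow> enat) \<Rightarrow> ('w \<times> bool) list set" where
  "coxeter_relators S n =
     {concat (replicate k [(r, True), (s, True)]) | r s k. r \<in> S \<and> s \<in> S \<and> n r s = enat k}"

locale coxeter_system = group W for W :: "'w monoid" +
  fixes S :: "'w set" and n :: "'w \<Rightarrow> 'w \<Rightarrow> enat"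
  assumes n_same: "s \<in> S \<Longrightarrow> n s s = 1"
    and n_sym: "r \<in> S \<Longrightarrow> s \<in> S \<Longrightarrow> n r s = n s r"
    and n_gt_1: "r \<in> S \<Longrightarrow> s \<in> S \<Longrightarrow> r \<noteq> s \<Longrightarrow> 1 < n r s"
    and presentation: "has_presentation W S (coxeter_relators S n)"

definition cox_length :: "'w monoid \<Rightarrow> 'w set \<Rightarrow> 'w \<Rightarrow> nat" where
  "cox_length W S w =
     (LEAST k. \<exists>ss. set ss \<subseteq> S \<and> length ss = k \<and> foldr (\<otimes>\<^bsub>W\<^esub>) ss \<one>\<^bsub>W\<^esub> = w)"


section \<open>Vector spaces over \<open>\<rat>(u)\<close> with a given basis\<close>

type_synonym Qu = "rat poly fract"

definition uu :: Qu where
  "uu = Fract [:0, 1:] 1"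

definition scale :: "Qu \<Rightarrow> ('b \<Rightarrow>\<^sub>0 Qu) \<Rightarrow> ('b \<Rightarrow>\<^sub>0 Qu)" where
  "scale c f = Poly_Mapping.map ((*) c) f"

lemma lookup_scale: "Poly_Mapping.lookup (scale c f) b = c * Poly_Mapping.lookup f b"
  by (simp add: scale_def Poly_Mapping.map.rep_eq when_def)

lemma vector_space_scale: "vector_space (scale :: Qu \<Rightarrow> ('b \<Rightarrow>\<^sub>0 Qu) \<Rightarrow> _)"
  by unfold_locales
    (simp_all add: poly_mapping_eq_iff fun_eq_iff lookup_scale lookup_add algebra_simps)

text \<open>The vector space with basis \<open>B\<close>; the basis vectors are \<open>Poly_Mapping.single b 1\<close>.\<close>

definition free_space :: "'b set \<Rightarrow> ('b \<Rightarrow>\<^sub>0 Qu) set" where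
  "free_space B = {f. Poly_Mapping.keys f \<subseteq> B}"

definition lin_ext :: "('b \<Rightarrow> ('c \<Rightarrow>\<^sub>0 Qu)) \<Rightarrow> ('b \<Rightarrow>\<^sub>0 Qu) \<Rightarrow> ('c \<Rightarrow>\<^sub>0 Qu)" where
  "lin_ext g f = (\<Sum>b\<in>Poly_Mapping.keys f. scale (Poly_Mapping.lookup f b) (g b))"

definition lin_form :: "('b \<Rightarrow> Qu) \<Rightarrow> ('b \<Rightarrow>\<^sub>0 Qu) \<Rightarrow> Qu" where
  "lin_form g f = (\<Sum>b\<in>Poly_Mapping.keys f. Poly_Mapping.lookup f b * g b)"

text \<open>
  The ring of all linear operators on \<open>free_space B\<close>.  Operators are made
  \<^const>\<open>undefined\<close> outside \<open>free_space B\<close>, so that they are determined by their action there.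
\<close>

definition End_ring :: "'b set \<Rightarrow> (('b \<Rightarrow>\<^sub>0 Qu) \<Rightarrow> ('b \<Rightarrow>\<^sub>0 Qu)) ring" where
  "End_ring B =
     \<lparr>carrier = {f \<in> free_space B \<rightarrow>\<^sub>E free_space B.
        (\<forall>x\<in>free_space B. \<forall>y\<in>free_space B. f (x + y) = f x + f y) \<and>
        (\<forall>c. \<forall>x\<in>free_space B. f (scale c x) = scale c (f x))},
      monoid.mult = (\<lambda>f g. \<lambda>x\<in>free_space B. f (g x)),
      one = (\<lambda>x\<in>free_space B. x),
      zero = (\<lambda>x\<in>free_space B. 0),
      add = (\<lambda>f g. \<lambda>x\<in>free_space B. f x + g x)\<rparr>"


section \<open>The Hecke algebra\<close>

abbreviation TT :: "'w \<Rightarrow> ('w \<Rightarrow>\<^sub>0 Qu)" where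
  "TT w \<equiv> Poly_Mapping.single w 1"

text \<open>
  The underlying vector space of \<open>H\<close> is the space with basis \<open>TT w\<close>, \<open>w \<in> W\<close>; only the
  multiplication of \<open>H\<close> is left open, and the axioms determine it uniquely.  That \<open>TT e\<close> is the
  identity follows from the other axioms unless \<open>S\<close> is empty.
\<close>

locale hecke_algebra = coxeter_system W S n + H: ring H
  for W :: "'w monoid" and S n and H :: "('w \<Rightarrow>\<^sub>0 Qu) ring" +
  assumes carrier_H: "carrier H = free_space (carrier W)"
    and zero_H: "\<zero>\<^bsub>H\<^esub> = 0"
    and add_H: "f \<in> carrier H \<Longrightarrow> g \<in> carrier H \<Longrightarrow> f \<oplus>\<^bsub>H\<^esub> g = f + g"
    and one_H: "\<one>\<^bsub>H\<^esub> = TT \<one>\<^bsub>W\<^esub>"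
    and scale_left: "f \<in> carrier H \<Longrightarrow> g \<in> carrier H \<Longrightarrow>
          scale c f \<otimes>\<^bsub>H\<^esub> g = scale c (f \<otimes>\<^bsub>H\<^esub> g)"
    and scale_right: "f \<in> carrier H \<Longrightarrow> g \<in> carrier H \<Longrightarrow>
          f \<otimes>\<^bsub>H\<^esub> scale c g = scale c (f \<otimes>\<^bsub>H\<^esub> g)"
    and mult_up: "s \<in> S \<Longrightarrow> w \<in> carrier W \<Longrightarrow>
          cox_length W S (s \<otimes>\<^bsub>W\<^esub> w) > cox_length W S w \<Longrightarrow>
          TT s \<otimes>\<^bsub>H\<^esub> TT w = TT (s \<otimes>\<^bsub>W\<^esub> w)"
    and mult_down: "s \<in> S \<Longrightarrow> w \<in> carrier W \<Longrightarrow>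
          cox_length W S (s \<otimes>\<^bsub>W\<^esub> w) < cox_length W S w \<Longrightarrow>
          TT s \<otimes>\<^bsub>H\<^esub> TT w = scale (uu^2) (TT (s \<otimes>\<^bsub>W\<^esub> w)) + scale (uu^2 - 1) (TT w)"

definition ind_char :: "'w monoid \<Rightarrow> 'w set \<Rightarrow> ('w \<Rightarrow>\<^sub>0 Qu) \<Rightarrow> Qu" where
  "ind_char W S = lin_form (\<lambda>w. uu ^ (2 * cox_length W S w))"

definition sgn_char :: "'w monoid \<Rightarrow> 'w set \<Rightarrow> ('w \<Rightarrow>\<^sub>0 Qu) \<Rightarrow> Qu" where
  "sgn_char W S = lin_form (\<lambda>w. (- 1) ^ cox_length W S w)"


section \<open>Labeled digraphs\<close>

datatype edge_kind = Solid | Dashed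

record ('v, 'e, 's) labeled_digraph = "('v, 'e) pre_digraph" +
  label :: "'e \<Rightarrow> 's"
  kind :: "'e \<Rightarrow> edge_kind"

definition underlying :: "('v, 'e, 's) labeled_digraph \<Rightarrow> ('v, 'e) pre_digraph" where
  "underlying \<Gamma> = pre_digraph.truncate \<Gamma>"

definition S_labeled_digraph :: "'s set \<Rightarrow> ('v, 'e, 's) labeled_digraph \<Rightarrow> bool" where
  "S_labeled_digraph S \<Gamma> \<longleftrightarrow>
     loopfree_digraph (underlying \<Gamma>) \<and>
     label \<Gamma> ` arcs \<Gamma> \<subseteq> S \<and>
     (\<forall>s\<in>S. \<forall>\<alpha>\<in>verts \<Gamma>. \<exists>!e. e \<in> arcs \<Gamma> \<and> label \<Gamma> e = s \<and> (tail \<Gamma> e = \<alpha> \<or> head \<Gamma> e = \<alpha>))"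

definition edge_at :: "('v, 'e, 's) labeled_digraph \<Rightarrow> 's \<Rightarrow> 'v \<Rightarrow> 'e" where
  "edge_at \<Gamma> s \<alpha> = (THE e. e \<in> arcs \<Gamma> \<and> label \<Gamma> e = s \<and> (tail \<Gamma> e = \<alpha> \<or> head \<Gamma> e = \<alpha>))"

definition tau_vert :: "('v, 'e, 's) labeled_digraph \<Rightarrow> 's \<Rightarrow> 'v \<Rightarrow> ('v \<Rightarrow>\<^sub>0 Qu)" where
  "tau_vert \<Gamma> s \<alpha> =
     (let e = edge_at \<Gamma> s \<alpha>; vec = (\<lambda>c \<gamma>. Poly_Mapping.single \<gamma> c)
      in case kind \<Gamma> e of
           Solid \<Rightarrow>
             if tail \<Gamma> e = \<alpha> then vec 1 (head \<Gamma> e)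
             else vec (uu^2 - 1) \<alpha> + vec (uu^2) (tail \<Gamma> e)
         | Dashed \<Rightarrow>
             if tail \<Gamma> e = \<alpha> then vec uu \<alpha> + vec (uu + 1) (head \<Gamma> e)
             else vec (uu^2 - uu - 1) \<alpha> + vec (uu^2 - uu) (tail \<Gamma> e))"

abbreviation MM :: "('v, 'e, 's) labeled_digraph \<Rightarrow> ('v \<Rightarrow>\<^sub>0 Qu) set" where
  "MM \<Gamma> \<equiv> free_space (verts \<Gamma>)"

definition tau :: "('v, 'e, 's) labeled_digraph \<Rightarrow> 's \<Rightarrow> ('v \<Rightarrow>\<^sub>0 Qu) \<Rightarrow> ('v \<Rightarrow>\<^sub>0 Qu)" where
  "tau \<Gamma> s = (\<lambda>x\<in>MM \<Gamma>. lin_ext (tau_vert \<Gamma> s) x)"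


section \<open>\<open>W\<close>-digraphs and their modules\<close>

definition is_tau_hom ::
  "'w set \<Rightarrow> ('w \<Rightarrow>\<^sub>0 Qu) ring \<Rightarrow> ('v, 'e, 'w) labeled_digraph \<Rightarrow>
     (('w \<Rightarrow>\<^sub>0 Qu) \<Rightarrow> ('v \<Rightarrow>\<^sub>0 Qu) \<Rightarrow> ('v \<Rightarrow>\<^sub>0 Qu)) \<Rightarrow> bool"
where
  "is_tau_hom S H \<Gamma> \<phi> \<longleftrightarrow>
     \<phi> \<in> ring_hom H (End_ring (verts \<Gamma>)) \<and>
     (\<forall>c. \<forall>h\<in>carrier H. \<phi> (scale c h) = (\<lambda>x\<in>MM \<Gamma>. scale c (\<phi> h x))) \<and>
     (\<forall>s\<in>S. \<phi> (TT s) = tau \<Gamma> s)"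

definition W_digraph ::
  "'w set \<Rightarrow> ('w \<Rightarrow>\<^sub>0 Qu) ring \<Rightarrow> ('v, 'e, 'w) labeled_digraph \<Rightarrow> bool"
where
  "W_digraph S H \<Gamma> \<longleftrightarrow> S_labeled_digraph S \<Gamma> \<and> (\<exists>\<phi>. is_tau_hom S H \<Gamma> \<phi>)"

text \<open>
  Since the \<open>TT s\<close> generate the Hecke algebra, the homomorphism is unique on \<open>carrier H\<close>;
  the choice operator only has to pick values outside \<open>carrier H\<close>.
\<close>

definition action ::
  "'w set \<Rightarrow> ('w \<Rightarrow>\<^sub>0 Qu) ring \<Rightarrow> ('v, 'e, 'w) labeled_digraph \<Rightarrow>
     ('w \<Rightarrow>\<^sub>0 Qu) \<Rightarrow> ('v \<Rightarrow>\<^sub>0 Qu) \<Rightarrow> ('v \<Rightarrow>\<^sub>0 Qu)"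
where
  "action S H \<Gamma> = (SOME \<phi>. is_tau_hom S H \<Gamma> \<phi>)"

definition weight_space ::
  "'w set \<Rightarrow> ('w \<Rightarrow>\<^sub>0 Qu) ring \<Rightarrow> ('v, 'e, 'w) labeled_digraph \<Rightarrow>
     (('w \<Rightarrow>\<^sub>0 Qu) \<Rightarrow> Qu) \<Rightarrow> ('v \<Rightarrow>\<^sub>0 Qu) set"
where
  "weight_space S H \<Gamma> \<chi> = {v \<in> MM \<Gamma>. \<forall>h\<in>carrier H. action S H \<Gamma> h v = scale (\<chi> h) v}"


section \<open>Components\<close>

text \<open>
  \<^const>\<open>connected\<close> from \<^theory>\<open>Graph_Theory.Digraph_Component\<close> ignores the direction of arcs.
\<close>

definition components :: "('v, 'e) pre_digraph \<Rightarrow> ('v, 'e) pre_digraph set" where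
  "components G = {C. pre_digraph.max_subgraph G connected C}"

definition acyclic_digraph :: "('v, 'e) pre_digraph \<Rightarrow> bool" where
  "acyclic_digraph G \<longleftrightarrow> \<not> (\<exists>v p. p \<noteq> [] \<and> pre_digraph.awalk G v p v)"

end

theory Submission
  imports Defs
begin

text \<open>
  The first step is the same for both characters.  Since \<open>TT w\<close> is the product of the
  \<open>TT s\<close> along a reduced word of \<open>w\<close>, the weight space of the character with value \<open>c\<^sup>l\<close> at
  elements of length \<open>l\<close> is the set of common eigenvectors of all \<open>\<tau>\<^sub>s\<close> with eigenvalue \<open>c\<close>
  (\<open>weight_space_iff_generators\<close>).  Each \<open>\<tau>\<^sub>s\<close> acts in two-dimensional blocks, one for each edge
  labeled \<open>s\<close>, so being such an eigenvector is a condition on the two coefficients at the ends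
  of each edge: for \<open>ind\<close> (\<open>c = u\<^sup>2\<close>) they are equal, and for \<open>sgn\<close> (\<open>c = -1\<close>) the coefficient
  at the tail is a nonzero weight times the coefficient at the head, the weight being \<open>-u\<^sup>2\<close> for
  a solid and \<open>-u(u-1)/(u+1)\<close> for a dashed edge (\<open>tau_ind_iff\<close>, \<open>tau_sgn_iff\<close>).

  So \<open>ind\<close>-vectors are the functions that are constant on connected components, which gives
  (i).  A \<open>sgn\<close>-vector is determined on a component by any one of its coefficients, and (ii)
  asks on which components the edge conditions have a nonzero solution.  Both weights vanish at
  \<open>u = 0\<close>; hence the product of the weights around a directed circuit is not \<open>1\<close>, and a
  \<open>sgn\<close>-vector vanishes on every component with a circuit (\<open>sgn_vector_circuit\<close>).

  On an acyclic component a solution is built as in Newman's lemma: every vertex descends to a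
  sink, and the coefficient at a vertex is the product of the weights along a descent to a sink.
  That the sink and the product do not depend on the descent (\<open>unique_sink\<close>) follows by
  well-founded induction from a weighted local confluence: two edges out of a vertex \<open>\<alpha>\<close>,
  labeled \<open>s\<close> and \<open>t\<close>, can be continued to a common vertex with equal products
  (\<open>local_confluence\<close>).  This is where the \<open>W\<close>-digraph structure and \<open>n s t < \<infinity>\<close> enter.  The
  operators \<open>\<tau>\<^sub>s\<close>, \<open>\<tau>\<^sub>t\<close> satisfy a braid relation of some length \<open>K \<ge> 1\<close>, and the usual
  alternating sum over the dihedral group of order \<open>2K\<close>, applied to \<open>\<alpha>\<close>, is an eigenvector
  \<open>y\<close> of both operators with eigenvalue \<open>-1\<close>.  At \<open>u = 0\<close> the operators \<open>\<tau>\<^sub>s\<close> and \<open>\<tau>\<^sub>t\<close>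
  move a vertex to the head of its edge, up to sign, and only the longest term of the sum
  survives.  Hence the two sides of the braid relation lead from \<open>\<alpha>\<close> to one and the same vertex
  \<open>\<delta>\<close>, one descent beginning with \<open>s\<close> and the other with \<open>t\<close>, and the coefficient of \<open>y\<close> at
  \<open>\<delta>\<close> is not zero.  Comparing the coefficients of \<open>y\<close> at \<open>\<alpha>\<close> and \<open>\<delta>\<close> along both descents
  shows that the products agree.

  The braid relation is obtained from the associativity of \<open>H\<close>, without root systems:
  evaluating \<open>TT s \<cdot> TT w \<cdot> TT t\<close> in two ways shows that \<open>sw = wt\<close> whenever \<open>sw\<close> and \<open>wt\<close>
  are longer than \<open>w\<close> but \<open>swt\<close> is not longer than these (\<open>folding\<close>), and this makes the two
  alternating words in \<open>s\<close> and \<open>t\<close> meet at the last length up to which both are reduced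
  (\<open>ex_braid\<close>).
\<close>

section \<open>Length in a Coxeter group\<close>

fun alternate :: "('a \<Rightarrow> 'a) \<Rightarrow> ('a \<Rightarrow> 'a) \<Rightarrow> nat \<Rightarrow> 'a \<Rightarrow> 'a" where
  "alternate f g 0 x = x"
| "alternate f g (Suc k) x = f (alternate g f k x)"

lemma alternate_Suc_inner:
  "alternate f g (Suc k) x = alternate f g k ((if even k then f else g) x)"
  by (induction k arbitrary: f g) auto

context coxeter_system
begin

abbreviation len :: "'w \<Rightarrow> nat" where "len \<equiv> cox_length W S"

abbreviation word :: "'w list \<Rightarrow> 'w" where
  "word ss \<equiv> foldr (\<otimes>\<^bsub>W\<^esub>) ss \<one>\<^bsub>W\<^esub>"

lemma generator_closed [simp]: "s \<in> S \<Longrightarrow> s \<in> carrier W"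
  using presentation by (auto simp: has_presentation_def)

lemma word_closed [simp]: "set ss \<subseteq> S \<Longrightarrow> word ss \<in> carrier W"
  by (induction ss) auto

lemma word_append:
  "set ss \<subseteq> S \<Longrightarrow> set ts \<subseteq> S \<Longrightarrow> word (ss @ ts) = word ss \<otimes>\<^bsub>W\<^esub> word ts"
  by (induction ss) (auto simp: m_assoc)

lemma word_value_eq_word: "word_value W (map (\<lambda>s. (s, True)) ss) = word ss"
  by (induction ss) (auto simp: word_value_def)

lemma relator_word:
  assumes "r \<in> S" "s \<in> S" "n r s = enat k"
  shows "word (concat (replicate k [r, s])) = \<one>\<^bsub>W\<^esub>"
proof -
  define R where "R = concat (replicate k [(r, True), (s, True)])"
  have R: "R \<in> coxeter_relators S n"
    using assms unfolding coxeter_relators_def R_def by blast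
  have "pres_eq S (coxeter_relators S n) R []"
    using pres_eq.relator[OF R, of S "[]" "[]"] by simp
  moreover have "fst ` set R \<subseteq> S"
    using assms by (auto simp: R_def)
  ultimately have "word_value W R = word_value W []"
    using presentation unfolding has_presentation_def by (metis empty_subsetI image_empty list.set(1))
  moreover have "R = map (\<lambda>s. (s, True)) (concat (replicate k [r, s]))"
    by (simp add: R_def map_concat)
  ultimately show ?thesis
    by (simp only: word_value_eq_word) (simp add: word_value_def)
qed

lemma generator_square [simp]: "s \<in> S \<Longrightarrow> s \<otimes>\<^bsub>W\<^esub> s = \<one>\<^bsub>W\<^esub>"
  using relator_word[of s s 1] n_same[of s] by (simp add: one_enat_def)

lemma generator_cancel [simp]:
  assumes "s \<in> S" "w \<in> carrier W"
  shows "s \<otimes>\<^bsub>W\<^esub> (s \<otimes>\<^bsub>W\<^esub> w) = w" "w \<otimes>\<^bsub>W\<^esub> s \<otimes>\<^bsub>W\<^esub> s = w"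
  using assms m_assoc[of s s w] m_assoc[of w s s] by simp_all

lemma inv_generator: "s \<in> S \<Longrightarrow> inv\<^bsub>W\<^esub> s = s"
  by (rule inv_equality) auto

lemma ex_word:
  assumes "w \<in> carrier W"
  shows "\<exists>ss. set ss \<subseteq> S \<and> word ss = w"
proof -
  have "w \<in> generate W S" using assms presentation by (simp add: has_presentation_def)
  then show ?thesis
  proof (induction rule: generate.induct)
    case one
    show ?case by (intro exI[of _ "[]"]) simp
  next
    case (incl s)
    then show ?case by (intro exI[of _ "[s]"]) simp
  next
    case (inv s)
    then show ?case by (intro exI[of _ "[s]"]) (simp add: inv_generator)
  next
    case (eng v w)
    then obtain ss ts where "set ss \<subseteq> S" "word ss = v" "set ts \<subseteq> S" "word ts = w" by blast
    then show ?case by (intro exI[of _ "ss @ ts"]) (simp add: word_append del: foldr_append)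
  qed
qed

text \<open>
  Every Coxeter relator has even length, so the parity of the length of a word is an invariant
  of the group element.
\<close>

lemma pres_eq_even_length:
  "pres_eq X (coxeter_relators S n) p q \<Longrightarrow> even (length p) = even (length q)"
proof (induction rule: pres_eq.induct)
  case (relator r p q)
  then obtain a b k where "r = concat (replicate k [(a, True), (b, True)])"
    by (auto simp: coxeter_relators_def)
  then have "even (length r)" by (simp add: length_concat sum_list_replicate)
  then show ?case by simp
qed auto

lemma word_even_length:
  assumes "set ss \<subseteq> S" "set ts \<subseteq> S" "word ss = word ts"
  shows "even (length ss) = even (length ts)"
proof -
  let ?l = "map (\<lambda>s. (s, True))"
  have "fst ` set (?l ss) \<subseteq> S" "fst ` set (?l ts) \<subseteq> S" using assms by (auto simp: image_image)
  then have "pres_eq S (coxeter_relators S n) (?l ss) (?l ts)"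
    using presentation assms(3) unfolding has_presentation_def by (metis word_value_eq_word)
  from pres_eq_even_length[OF this] show ?thesis by simp
qed

lemma len_word_le: "set ss \<subseteq> S \<Longrightarrow> len (word ss) \<le> length ss"
  unfolding cox_length_def by (rule Least_le) blast

lemma ex_reduced_word:
  assumes "w \<in> carrier W"
  shows "\<exists>ss. set ss \<subseteq> S \<and> length ss = len w \<and> word ss = w"
  unfolding cox_length_def by (rule LeastI_ex) (use ex_word[OF assms] in blast)

lemma even_len_word:
  assumes "set ss \<subseteq> S"
  shows "even (len (word ss)) = even (length ss)"
  using ex_reduced_word[of "word ss"] word_even_length[OF assms] assms
  by (metis word_closed)

lemma len_one [simp]: "len \<one>\<^bsub>W\<^esub> = 0"
  using len_word_le[of "[]"] by simp

text \<open>
  Prepending a letter to a reduced word changes the length by at most one, in either direction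
  because generators are involutions; by parity it does change.
\<close>

lemma len_mult_left:
  assumes "s \<in> S" "w \<in> carrier W"
  shows "len (s \<otimes>\<^bsub>W\<^esub> w) = Suc (len w) \<or> len w = Suc (len (s \<otimes>\<^bsub>W\<^esub> w))"
proof -
  have le: "len (s \<otimes>\<^bsub>W\<^esub> v) \<le> Suc (len v)" if v: "v \<in> carrier W" for v
  proof -
    obtain ss where "set ss \<subseteq> S" "length ss = len v" "word ss = v"
      using ex_reduced_word[OF v] by blast
    then show ?thesis using len_word_le[of "s # ss"] assms(1) by simp
  qed
  obtain ss where ss: "set ss \<subseteq> S" "length ss = len w" "word ss = w"
    using ex_reduced_word[OF assms(2)] by blast
  have "even (len (s \<otimes>\<^bsub>W\<^esub> w)) \<noteq> even (len w)"
    using even_len_word[of "s # ss"] ss assms(1) by simp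
  moreover have "len (s \<otimes>\<^bsub>W\<^esub> w) \<le> Suc (len w)" "len w \<le> Suc (len (s \<otimes>\<^bsub>W\<^esub> w))"
    using le[of w] le[of "s \<otimes>\<^bsub>W\<^esub> w"] assms by auto
  ultimately show ?thesis by (metis le_SucE le_antisym)
qed

lemma len_mult_right:
  assumes "t \<in> S" "w \<in> carrier W"
  shows "len (w \<otimes>\<^bsub>W\<^esub> t) = Suc (len w) \<or> len w = Suc (len (w \<otimes>\<^bsub>W\<^esub> t))"
proof -
  have le: "len (v \<otimes>\<^bsub>W\<^esub> t) \<le> Suc (len v)" if v: "v \<in> carrier W" for v
  proof -
    obtain ss where "set ss \<subseteq> S" "length ss = len v" "word ss = v"
      using ex_reduced_word[OF v] by blast
    then show ?thesis using len_word_le[of "ss @ [t]"] word_append[of ss "[t]"] assms(1) by simp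
  qed
  obtain ss where ss: "set ss \<subseteq> S" "length ss = len w" "word ss = w"
    using ex_reduced_word[OF assms(2)] by blast
  have "even (len (w \<otimes>\<^bsub>W\<^esub> t)) \<noteq> even (len w)"
    using even_len_word[of "ss @ [t]"] word_append[of ss "[t]"] ss assms(1) by simp
  moreover have "len (w \<otimes>\<^bsub>W\<^esub> t) \<le> Suc (len w)" "len w \<le> Suc (len (w \<otimes>\<^bsub>W\<^esub> t))"
    using le[of w] le[of "w \<otimes>\<^bsub>W\<^esub> t"] assms by auto
  ultimately show ?thesis by (metis le_SucE le_antisym)
qed

lemma len_generator [simp]: "s \<in> S \<Longrightarrow> len s = 1"
  using len_mult_left[of s "\<one>\<^bsub>W\<^esub>"] by simp

lemma ex_left_descent:
  assumes "w \<in> carrier W" "len w = Suc k"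
  shows "\<exists>s\<in>S. \<exists>v\<in>carrier W. w = s \<otimes>\<^bsub>W\<^esub> v \<and> len v = k"
proof -
  obtain ss where ss: "set ss \<subseteq> S" "length ss = len w" "word ss = w"
    using ex_reduced_word[OF assms(1)] by blast
  then obtain s ts where st: "ss = s # ts" using assms by (cases ss) auto
  have "len (word ts) \<le> k" using len_word_le[of ts] ss st assms by simp
  moreover have "w = s \<otimes>\<^bsub>W\<^esub> word ts" using ss st by simp
  ultimately have "len (word ts) = k"
    using len_mult_left[of s "word ts"] ss st assms(2) by auto
  with \<open>w = _\<close> show ?thesis using ss(1) st word_closed[of ts]
    by (intro bexI[of _ s] bexI[of _ "word ts"]) auto
qed

abbreviation alt_elt :: "'w \<Rightarrow> 'w \<Rightarrow> nat \<Rightarrow> 'w" where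
  "alt_elt s t k \<equiv> alternate ((\<otimes>\<^bsub>W\<^esub>) s) ((\<otimes>\<^bsub>W\<^esub>) t) k \<one>\<^bsub>W\<^esub>"

lemma alternate_closed:
  "s \<in> S \<Longrightarrow> t \<in> S \<Longrightarrow> w \<in> carrier W \<Longrightarrow> alternate ((\<otimes>\<^bsub>W\<^esub>) s) ((\<otimes>\<^bsub>W\<^esub>) t) k w \<in> carrier W"
  by (induction k arbitrary: s t) auto

lemma alternate_mult_right:
  "s \<in> S \<Longrightarrow> t \<in> S \<Longrightarrow> w \<in> carrier W \<Longrightarrow> alternate ((\<otimes>\<^bsub>W\<^esub>) s) ((\<otimes>\<^bsub>W\<^esub>) t) k w = alt_elt s t k \<otimes>\<^bsub>W\<^esub> w"
  by (induction k arbitrary: s t) (auto simp: m_assoc alternate_closed)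

lemma alt_elt_Suc_right:
  "s \<in> S \<Longrightarrow> t \<in> S \<Longrightarrow> alt_elt s t (Suc k) = alt_elt s t k \<otimes>\<^bsub>W\<^esub> (if even k then s else t)"
  using alternate_mult_right[of s t "if even k then s else t" k]
  by (auto simp: alternate_Suc_inner simp del: alternate.simps(2))

lemma alt_elt_relator:
  assumes "s \<in> S" "t \<in> S" "n s t = enat m"
  shows "alt_elt s t (2 * m) = \<one>\<^bsub>W\<^esub>"
proof -
  have "alt_elt s t (2 * k) = word (concat (replicate k [s, t]))" for k
    by (induction k) auto
  then show ?thesis using relator_word[OF assms] by simp
qed

end

section \<open>Folding and braid relations in the Hecke algebra\<close>

context hecke_algebra
begin

lemma TT_closed [simp]: "w \<in> carrier W \<Longrightarrow> TT w \<in> carrier H"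
  by (simp add: carrier_H free_space_def)

lemma scale_closed [simp]: "h \<in> carrier H \<Longrightarrow> scale c h \<in> carrier H"
  by (fastforce simp: carrier_H free_space_def in_keys_iff lookup_scale)

text \<open>
  The axioms of \<open>H\<close> only speak of left multiplication by generators; a reduced word of \<open>w\<close>
  extended by \<open>t\<close> transfers the length-increasing rule to the right.
\<close>

lemma TT_mult_right:
  assumes "w \<in> carrier W" "t \<in> S" "len (w \<otimes>\<^bsub>W\<^esub> t) = Suc (len w)"
  shows "TT w \<otimes>\<^bsub>H\<^esub> TT t = TT (w \<otimes>\<^bsub>W\<^esub> t)"
  using assms(1,3)
proof (induction "len w" arbitrary: w)
  case 0
  then obtain ss where "length ss = 0" "word ss = w" using ex_reduced_word by metis
  then have "w = \<one>\<^bsub>W\<^esub>" by simp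
  then show ?case using assms(2) by (simp flip: one_H)
next
  case (Suc k)
  then obtain s v where v: "s \<in> S" "v \<in> carrier W" "w = s \<otimes>\<^bsub>W\<^esub> v" "len v = k"
    using ex_left_descent[of w k] by metis
  have assoc: "w \<otimes>\<^bsub>W\<^esub> t = s \<otimes>\<^bsub>W\<^esub> (v \<otimes>\<^bsub>W\<^esub> t)" using v assms(2) by (simp add: m_assoc)
  have vt: "len (v \<otimes>\<^bsub>W\<^esub> t) = Suc k"
    using len_mult_left[of s "v \<otimes>\<^bsub>W\<^esub> t"] len_mult_right[of t v] v assms(2) Suc.prems Suc.hyps assoc
    by auto
  have "TT w \<otimes>\<^bsub>H\<^esub> TT t = (TT s \<otimes>\<^bsub>H\<^esub> TT v) \<otimes>\<^bsub>H\<^esub> TT t"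
    using mult_up[of s v] v Suc.hyps by simp
  also have "\<dots> = TT s \<otimes>\<^bsub>H\<^esub> (TT v \<otimes>\<^bsub>H\<^esub> TT t)" using v assms(2) by (simp add: H.m_assoc)
  also have "TT v \<otimes>\<^bsub>H\<^esub> TT t = TT (v \<otimes>\<^bsub>W\<^esub> t)" using Suc.hyps(1)[of v] v vt by simp
  also have "TT s \<otimes>\<^bsub>H\<^esub> TT (v \<otimes>\<^bsub>W\<^esub> t) = TT (w \<otimes>\<^bsub>W\<^esub> t)"
    using mult_up[of s "v \<otimes>\<^bsub>W\<^esub> t"] v assms(2) vt assoc Suc.prems Suc.hyps by simp
  finally show ?case .
qed

lemma uu_sq_neq_1: "uu^2 \<noteq> 1"
  by (simp add: uu_def power2_eq_square One_fract_def eq_fract one_pCons)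

lemma TT_generator_square:
  assumes "t \<in> S"
  shows "TT t \<otimes>\<^bsub>H\<^esub> TT t = scale (uu^2) \<one>\<^bsub>H\<^esub> + scale (uu^2 - 1) (TT t)"
  using mult_down[of t t] assms by (simp add: one_H)

text \<open>
  The two evaluations of \<open>TT s \<cdot> TT w \<cdot> TT t\<close> are \<open>u\<^sup>2 TT (swt) + (u\<^sup>2 - 1) TT (wt)\<close> and
  \<open>u\<^sup>2 TT (swt) + (u\<^sup>2 - 1) TT (sw)\<close>.  Since \<open>u\<^sup>2 \<noteq> 1\<close>, the basis elements \<open>TT (wt)\<close> and
  \<open>TT (sw)\<close> coincide.
\<close>

lemma folding:
  assumes "s \<in> S" "t \<in> S" "w \<in> carrier W"
    and "len (s \<otimes>\<^bsub>W\<^esub> w) = Suc (len w)" "len (w \<otimes>\<^bsub>W\<^esub> t) = Suc (len w)"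
    and "len (s \<otimes>\<^bsub>W\<^esub> w \<otimes>\<^bsub>W\<^esub> t) \<noteq> Suc (Suc (len w))"
  shows "s \<otimes>\<^bsub>W\<^esub> w = w \<otimes>\<^bsub>W\<^esub> t"
proof -
  define v where "v = s \<otimes>\<^bsub>W\<^esub> w \<otimes>\<^bsub>W\<^esub> t"
  have v: "v \<in> carrier W" "v \<otimes>\<^bsub>W\<^esub> t = s \<otimes>\<^bsub>W\<^esub> w" "s \<otimes>\<^bsub>W\<^esub> (w \<otimes>\<^bsub>W\<^esub> t) = v"
    using assms by (simp_all add: v_def m_assoc)
  have len_v: "len v = len w"
    using len_mult_right[of t "s \<otimes>\<^bsub>W\<^esub> w"] assms v_def by auto
  have "scale (uu^2) (TT v) + scale (uu^2 - 1) (TT (w \<otimes>\<^bsub>W\<^esub> t)) = TT s \<otimes>\<^bsub>H\<^esub> TT (w \<otimes>\<^bsub>W\<^esub> t)"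
    using mult_down[of s "w \<otimes>\<^bsub>W\<^esub> t"] assms v len_v by simp
  also have "\<dots> = TT s \<otimes>\<^bsub>H\<^esub> (TT w \<otimes>\<^bsub>H\<^esub> TT t)"
    using TT_mult_right[of w t] assms by simp
  also have "\<dots> = (TT s \<otimes>\<^bsub>H\<^esub> TT w) \<otimes>\<^bsub>H\<^esub> TT t"
    using assms by (simp add: H.m_assoc)
  also have "\<dots> = TT (v \<otimes>\<^bsub>W\<^esub> t) \<otimes>\<^bsub>H\<^esub> TT t"
    using mult_up[of s w] assms v by simp
  also have "\<dots> = (TT v \<otimes>\<^bsub>H\<^esub> TT t) \<otimes>\<^bsub>H\<^esub> TT t"
    using TT_mult_right[of v t] assms v len_v by simp
  also have "\<dots> = TT v \<otimes>\<^bsub>H\<^esub> (scale (uu^2) \<one>\<^bsub>H\<^esub> \<oplus>\<^bsub>H\<^esub> scale (uu^2 - 1) (TT t))"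
    using assms v by (simp add: H.m_assoc TT_generator_square add_H)
  also have "\<dots> = scale (uu^2) (TT v) \<oplus>\<^bsub>H\<^esub> scale (uu^2 - 1) (TT v \<otimes>\<^bsub>H\<^esub> TT t)"
    using assms(2) v(1) by (simp add: H.r_distr scale_right)
  also have "TT v \<otimes>\<^bsub>H\<^esub> TT t = TT (s \<otimes>\<^bsub>W\<^esub> w)"
    using TT_mult_right[of v t] assms v len_v by simp
  also have "scale (uu^2) (TT v) \<oplus>\<^bsub>H\<^esub> scale (uu^2 - 1) (TT (s \<otimes>\<^bsub>W\<^esub> w)) =
      scale (uu^2) (TT v) + scale (uu^2 - 1) (TT (s \<otimes>\<^bsub>W\<^esub> w))"
    using assms(1,3) v(1) by (intro add_H) simp_all
  finally have "scale (uu^2 - 1) (TT (w \<otimes>\<^bsub>W\<^esub> t)) = scale (uu^2 - 1) (TT (s \<otimes>\<^bsub>W\<^esub> w))"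
    by simp
  then have "Poly_Mapping.lookup (scale (uu^2 - 1) (TT (w \<otimes>\<^bsub>W\<^esub> t))) (s \<otimes>\<^bsub>W\<^esub> w) = uu^2 - 1"
    by (simp add: lookup_scale)
  then show ?thesis using uu_sq_neq_1
    by (auto simp: lookup_scale lookup_single when_def split: if_splits)
qed

text \<open>
  The relator for \<open>s\<close> and \<open>t\<close> bounds the lengths of reduced alternating words.  Let \<open>K + 1\<close>
  be the first length at which one of the alternating words fails to be reduced.  That word arises from the reduced word of length
  \<open>K - 1\<close> between its first and last letters by multiplying with a generator on both sides, and
  folding identifies its initial and final parts of length \<open>K\<close>.
\<close>

lemma ex_braid:
  assumes "s \<in> S" "t \<in> S" "n s t < \<infinity>"
  shows "\<exists>K\<ge>1. alt_elt s t K = alt_elt t s K \<and>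
           (\<forall>k\<le>K. len (alt_elt s t k) = k \<and> len (alt_elt t s k) = k)"
proof -
  let ?red = "\<lambda>k. len (alt_elt s t k) = k \<and> len (alt_elt t s k) = k"
  obtain m where m: "n s t = enat m" using assms(3) by auto
  have "m > 0" using n_same[of s] n_gt_1[of s t] assms m
    by (cases "s = t") (auto simp: one_enat_def zero_enat_def intro: gr0I)
  then have "\<not> ?red (2 * m)" using alt_elt_relator[OF assms(1,2) m] by simp
  define L where "L = (LEAST k. \<not> ?red k)"
  have L: "\<not> ?red L" unfolding L_def by (rule LeastI) fact
  have below: "?red k" if "k < L" for k
    using not_less_Least[of k "\<lambda>k. \<not> ?red k"] that unfolding L_def by blast
  have red0: "?red 0" and red1: "?red 1" using assms by auto
  have "L \<noteq> 0" "L \<noteq> Suc 0" using L red0 red1 by (metis One_nat_def)+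
  then obtain k where k: "L = Suc (Suc k)" by (metis not0_implies_Suc)
  \<comment> \<open>The situation is symmetric in the two generators; \<open>x\<close> is the first letter of a word that fails.\<close>
  have *: "alt_elt x y (Suc k) = alt_elt y x (Suc k)"
    if "x \<in> S" "y \<in> S" "len (alt_elt x y L) \<noteq> L"
      "\<And>k. k < L \<Longrightarrow> len (alt_elt x y k) = k \<and> len (alt_elt y x k) = k" for x y
  proof -
    define z where "z = (if even k then y else x)"
    have z: "z \<in> S" using that z_def by simp
    have right: "alt_elt y x k \<otimes>\<^bsub>W\<^esub> z = alt_elt y x (Suc k)"
      using alt_elt_Suc_right[of y x k] that by (simp add: z_def del: alternate.simps(2))
    have c: "alt_elt y x k \<in> carrier W" using that by (simp add: alternate_closed)
    have "x \<otimes>\<^bsub>W\<^esub> alt_elt y x k \<otimes>\<^bsub>W\<^esub> z = alt_elt x y L"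
      using c z that right by (simp add: k m_assoc)
    then have "x \<otimes>\<^bsub>W\<^esub> alt_elt y x k = alt_elt y x k \<otimes>\<^bsub>W\<^esub> z"
      using folding[OF that(1) z c] that(3) that(4)[of k] that(4)[of "Suc k"] right k by simp
    then show ?thesis using right by simp
  qed
  have "alt_elt s t (Suc k) = alt_elt t s (Suc k)"
    using *[of s t] *[of t s] assms L below by metis
  then show ?thesis using below k by (intro exI[of _ "Suc k"]) (auto simp del: alternate.simps)
qed

end

section \<open>Specialization at \<open>u = 0\<close>\<close>

text \<open>
  The relation \<open>res0 x r\<close> holds if \<open>x\<close> lies in the local ring of rational functions without a
  pole at \<open>u = 0\<close> and has the value \<open>r\<close> there.
\<close>

definition res0 :: "Qu \<Rightarrow> rat \<Rightarrow> bool" where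
  "res0 x r \<longleftrightarrow> (\<exists>p q. poly q 0 \<noteq> 0 \<and> x = Fract p q \<and> r = poly p 0 / poly q 0)"

lemma res0I: "poly q 0 \<noteq> 0 \<Longrightarrow> r = poly p 0 / poly q 0 \<Longrightarrow> res0 (Fract p q) r"
  by (auto simp: res0_def)

lemma res0_unique:
  assumes "res0 x r" "res0 x r'"
  shows "r = r'"
proof -
  obtain p q where x: "poly q 0 \<noteq> 0" "x = Fract p q" "r = poly p 0 / poly q 0"
    using assms(1) by (auto simp: res0_def)
  obtain p' q' where x': "poly q' 0 \<noteq> 0" "x = Fract p' q'" "r' = poly p' 0 / poly q' 0"
    using assms(2) by (auto simp: res0_def)
  have "q \<noteq> 0" "q' \<noteq> 0" using x x' by auto
  then have "p * q' = p' * q" using x x' by (simp add: eq_fract)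
  then have "poly p 0 * poly q' 0 = poly p' 0 * poly q 0" by (metis poly_mult)
  then show ?thesis using x x' by (simp add: frac_eq_eq)
qed

lemma res0_0 [simp, intro]: "res0 0 0"
  unfolding Zero_fract_def by (rule res0I) auto

lemma res0_1 [simp, intro]: "res0 1 1"
  unfolding One_fract_def by (rule res0I) auto

lemma res0_uu [simp, intro]: "res0 uu 0"
  unfolding uu_def by (rule res0I) auto

lemma res0_add [intro]:
  assumes "res0 x r" "res0 y r'"
  shows "res0 (x + y) (r + r')"
proof -
  obtain p q where x: "poly q 0 \<noteq> 0" "x = Fract p q" "r = poly p 0 / poly q 0"
    using assms(1) by (auto simp: res0_def)
  obtain p' q' where y: "poly q' 0 \<noteq> 0" "y = Fract p' q'" "r' = poly p' 0 / poly q' 0"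
    using assms(2) by (auto simp: res0_def)
  have "q \<noteq> 0" "q' \<noteq> 0" using x y by auto
  then have "x + y = Fract (p * q' + p' * q) (q * q')" using x y by simp
  then show ?thesis using x y by (simp only:) (rule res0I, auto simp: field_simps)
qed

lemma res0_mult [intro]:
  assumes "res0 x r" "res0 y r'"
  shows "res0 (x * y) (r * r')"
proof -
  obtain p q where x: "poly q 0 \<noteq> 0" "x = Fract p q" "r = poly p 0 / poly q 0"
    using assms(1) by (auto simp: res0_def)
  obtain p' q' where y: "poly q' 0 \<noteq> 0" "y = Fract p' q'" "r' = poly p' 0 / poly q' 0"
    using assms(2) by (auto simp: res0_def)
  show ?thesis using x y by (auto intro!: res0I)
qed

lemma res0_uminus [intro]: "res0 x r \<Longrightarrow> res0 (- x) (- r)"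
  by (auto simp: res0_def) (metis minus_divide_left minus_fract poly_minus)

lemma res0_diff [intro]: "res0 x r \<Longrightarrow> res0 y r' \<Longrightarrow> res0 (x - y) (r - r')"
  using res0_add[OF _ res0_uminus] by fastforce

lemma res0_power [intro]: "res0 x r \<Longrightarrow> res0 (x ^ k) (r ^ k)"
  by (induction k) auto

lemma uu_neq_0: "uu \<noteq> 0"
  by (simp add: uu_def Zero_fract_def eq_fract)

lemma uu_neq_1: "uu \<noteq> 1"
  using res0_unique[OF res0_uu] by fastforce

lemma uu_add_1_neq_0: "uu + 1 \<noteq> 0"
  using res0_unique[OF res0_add[OF res0_uu res0_1], of 0] by fastforce

lemma res0_inverse_uu_add_1: "res0 (inverse (uu + 1)) 1"
proof -
  have "uu + 1 = Fract [:1, 1:] 1"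
    by (simp add: uu_def One_fract_def one_pCons)
  then show ?thesis by (simp add: res0I)
qed

section \<open>Eigenvectors of \<open>\<tau>\<^sub>s\<close>\<close>

lemma underlying_simps [simp]:
  "verts (underlying \<Gamma>) = verts \<Gamma>" "arcs (underlying \<Gamma>) = arcs \<Gamma>"
  "tail (underlying \<Gamma>) = tail \<Gamma>" "head (underlying \<Gamma>) = head \<Gamma>"
  by (simp_all add: underlying_def pre_digraph.truncate_def)

lemma lookup_sum_poly_mapping:
  "Poly_Mapping.lookup (sum f A) x = (\<Sum>a\<in>A. Poly_Mapping.lookup (f a) x)"
  by (induction A rule: infinite_finite_induct) (auto simp: lookup_add)

lemma free_space_iff: "v \<in> free_space B \<longleftrightarrow> (\<forall>x. x \<notin> B \<longrightarrow> Poly_Mapping.lookup v x = 0)"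
  by (auto simp: free_space_def in_keys_iff)

lemma scale_zero [simp]: "scale 0 v = 0" "scale c 0 = 0"
  by (simp_all add: poly_mapping_eq_iff fun_eq_iff lookup_scale)

lemma free_space_closed [simp]:
  "v \<in> free_space B \<Longrightarrow> w \<in> free_space B \<Longrightarrow> v + w \<in> free_space B"
  "v \<in> free_space B \<Longrightarrow> scale c v \<in> free_space B"
  "0 \<in> free_space B"
  by (auto simp: free_space_iff lookup_add lookup_scale)

locale edge_labeled_digraph =
  fixes S :: "'s set" and \<Gamma> :: "('v, 'e, 's) labeled_digraph"
  assumes labeled: "S_labeled_digraph S \<Gamma>"
begin

lemma loopfree: "loopfree_digraph (underlying \<Gamma>)"
  using labeled by (simp add: S_labeled_digraph_def)

lemma arc_simps [simp]:
  assumes "e \<in> arcs \<Gamma>"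
  shows "tail \<Gamma> e \<in> verts \<Gamma>" "head \<Gamma> e \<in> verts \<Gamma>" "label \<Gamma> e \<in> S"
    "tail \<Gamma> e \<noteq> head \<Gamma> e" "head \<Gamma> e \<noteq> tail \<Gamma> e"
proof -
  interpret loopfree_digraph "underlying \<Gamma>" by (rule loopfree)
  show "tail \<Gamma> e \<in> verts \<Gamma>" "head \<Gamma> e \<in> verts \<Gamma>"
    "tail \<Gamma> e \<noteq> head \<Gamma> e" "head \<Gamma> e \<noteq> tail \<Gamma> e"
    using assms tail_in_verts[of e] head_in_verts[of e] no_loops[of e] by simp_all
  show "label \<Gamma> e \<in> S" using labeled assms by (auto simp: S_labeled_digraph_def)
qed

lemma edge_at:
  assumes "s \<in> S" "\<alpha> \<in> verts \<Gamma>"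
  shows "edge_at \<Gamma> s \<alpha> \<in> arcs \<Gamma>" "label \<Gamma> (edge_at \<Gamma> s \<alpha>) = s"
    "tail \<Gamma> (edge_at \<Gamma> s \<alpha>) = \<alpha> \<or> head \<Gamma> (edge_at \<Gamma> s \<alpha>) = \<alpha>"
proof -
  have "\<exists>!e. e \<in> arcs \<Gamma> \<and> label \<Gamma> e = s \<and> (tail \<Gamma> e = \<alpha> \<or> head \<Gamma> e = \<alpha>)"
    using labeled assms by (simp add: S_labeled_digraph_def)
  from theI'[OF this]
  show "edge_at \<Gamma> s \<alpha> \<in> arcs \<Gamma>" "label \<Gamma> (edge_at \<Gamma> s \<alpha>) = s"
    "tail \<Gamma> (edge_at \<Gamma> s \<alpha>) = \<alpha> \<or> head \<Gamma> (edge_at \<Gamma> s \<alpha>) = \<alpha>"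
    unfolding edge_at_def by simp_all
qed

lemma edge_at_eq:
  assumes "e \<in> arcs \<Gamma>" "tail \<Gamma> e = \<alpha> \<or> head \<Gamma> e = \<alpha>"
  shows "edge_at \<Gamma> (label \<Gamma> e) \<alpha> = e"
proof -
  have "label \<Gamma> e \<in> S" "\<alpha> \<in> verts \<Gamma>" using assms by auto
  then have "\<exists>!e'. e' \<in> arcs \<Gamma> \<and> label \<Gamma> e' = label \<Gamma> e \<and> (tail \<Gamma> e' = \<alpha> \<or> head \<Gamma> e' = \<alpha>)"
    using labeled by (simp add: S_labeled_digraph_def)
  then show ?thesis unfolding edge_at_def by (rule the1_equality) (use assms in auto)
qed

lemma edge_at_tail_head [simp]:
  assumes "e \<in> arcs \<Gamma>"
  shows "edge_at \<Gamma> (label \<Gamma> e) (tail \<Gamma> e) = e" "edge_at \<Gamma> (label \<Gamma> e) (head \<Gamma> e) = e"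
  using assms by (auto intro: edge_at_eq)

text \<open>
  The matrix of \<open>\<tau>\<^sub>s\<close> is block diagonal, with one block for each edge labeled \<open>s\<close>.
\<close>

lemma lookup_tau:
  assumes v: "v \<in> MM \<Gamma>" and e: "e \<in> arcs \<Gamma>" "label \<Gamma> e = s"
    and \<gamma>: "\<gamma> = tail \<Gamma> e \<or> \<gamma> = head \<Gamma> e"
  shows "Poly_Mapping.lookup (tau \<Gamma> s v) \<gamma> =
    Poly_Mapping.lookup v (tail \<Gamma> e) * Poly_Mapping.lookup (tau_vert \<Gamma> s (tail \<Gamma> e)) \<gamma> +
    Poly_Mapping.lookup v (head \<Gamma> e) * Poly_Mapping.lookup (tau_vert \<Gamma> s (head \<Gamma> e)) \<gamma>"
proof -
  let ?f = "\<lambda>b. Poly_Mapping.lookup v b * Poly_Mapping.lookup (tau_vert \<Gamma> s b) \<gamma>"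
  have other: "?f b = 0" if "b \<in> verts \<Gamma>" "b \<notin> {tail \<Gamma> e, head \<Gamma> e}" for b
  proof -
    have s: "s \<in> S" using e by auto
    note b = edge_at[OF s that(1)]
    have "edge_at \<Gamma> s b \<noteq> e" using b that by auto
    then have "\<gamma> \<notin> {tail \<Gamma> (edge_at \<Gamma> s b), head \<Gamma> (edge_at \<Gamma> s b)}"
      using edge_at_eq[OF b(1), of \<gamma>] edge_at_eq[OF e(1), of \<gamma>] b(2) e(2) \<gamma> by auto
    then show ?thesis using b(3)
      by (auto simp: tau_vert_def Let_def lookup_add lookup_single when_def split: edge_kind.splits)
  qed
  have "Poly_Mapping.lookup (tau \<Gamma> s v) \<gamma> = sum ?f (Poly_Mapping.keys v)"
    using v by (simp add: tau_def lin_ext_def lookup_sum_poly_mapping lookup_scale)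
  also have "\<dots> = sum ?f (Poly_Mapping.keys v \<union> {tail \<Gamma> e, head \<Gamma> e})"
    by (rule sum.mono_neutral_left) (auto simp: in_keys_iff)
  also have "\<dots> = sum ?f {tail \<Gamma> e, head \<Gamma> e}"
    using v other by (intro sum.mono_neutral_right) (auto simp: free_space_def)
  finally show ?thesis using e by simp
qed

lemma lookup_tau_tail:
  assumes "v \<in> MM \<Gamma>" "e \<in> arcs \<Gamma>"
  shows "Poly_Mapping.lookup (tau \<Gamma> (label \<Gamma> e) v) (tail \<Gamma> e) =
    (case kind \<Gamma> e of
       Solid \<Rightarrow> uu^2 * Poly_Mapping.lookup v (head \<Gamma> e)
     | Dashed \<Rightarrow> uu * Poly_Mapping.lookup v (tail \<Gamma> e) + (uu^2 - uu) * Poly_Mapping.lookup v (head \<Gamma> e))"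
  using assms
  by (subst lookup_tau[OF assms HOL.refl])
     (auto simp: tau_vert_def Let_def lookup_add lookup_single split: edge_kind.splits)

lemma lookup_tau_head:
  assumes "v \<in> MM \<Gamma>" "e \<in> arcs \<Gamma>"
  shows "Poly_Mapping.lookup (tau \<Gamma> (label \<Gamma> e) v) (head \<Gamma> e) =
    (case kind \<Gamma> e of
       Solid \<Rightarrow> Poly_Mapping.lookup v (tail \<Gamma> e) + (uu^2 - 1) * Poly_Mapping.lookup v (head \<Gamma> e)
     | Dashed \<Rightarrow> (uu + 1) * Poly_Mapping.lookup v (tail \<Gamma> e) + (uu^2 - uu - 1) * Poly_Mapping.lookup v (head \<Gamma> e))"
  using assms
  by (subst lookup_tau[OF assms HOL.refl])
     (auto simp: tau_vert_def Let_def lookup_add lookup_single split: edge_kind.splits)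

lemma tau_closed:
  assumes "v \<in> MM \<Gamma>" "s \<in> S"
  shows "tau \<Gamma> s v \<in> MM \<Gamma>"
proof -
  have "Poly_Mapping.lookup (tau_vert \<Gamma> s b) \<gamma> = 0" if "b \<in> verts \<Gamma>" "\<gamma> \<notin> verts \<Gamma>" for b \<gamma>
    using edge_at[OF assms(2) that(1)] that arc_simps[of "edge_at \<Gamma> s b"]
    by (auto simp: tau_vert_def Let_def lookup_add lookup_single when_def split: edge_kind.splits)
  moreover have "Poly_Mapping.keys v \<subseteq> verts \<Gamma>" using assms(1) by (simp add: free_space_def)
  ultimately show ?thesis using assms(1)
    by (auto simp: free_space_iff tau_def lin_ext_def lookup_sum_poly_mapping lookup_scale
        intro!: sum.neutral)
qed

lemma tau_eigen_iff_edges: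
  assumes v: "v \<in> MM \<Gamma>" and s: "s \<in> S"
  shows "tau \<Gamma> s v = scale c v \<longleftrightarrow>
    (\<forall>e\<in>arcs \<Gamma>. label \<Gamma> e = s \<longrightarrow>
       Poly_Mapping.lookup (tau \<Gamma> s v) (tail \<Gamma> e) = c * Poly_Mapping.lookup v (tail \<Gamma> e) \<and>
       Poly_Mapping.lookup (tau \<Gamma> s v) (head \<Gamma> e) = c * Poly_Mapping.lookup v (head \<Gamma> e))"
    (is "_ \<longleftrightarrow> ?R")
proof
  assume R: ?R
  show "tau \<Gamma> s v = scale c v"
  proof (rule poly_mapping_eqI)
    fix \<gamma>
    show "Poly_Mapping.lookup (tau \<Gamma> s v) \<gamma> = Poly_Mapping.lookup (scale c v) \<gamma>"
    proof (cases "\<gamma> \<in> verts \<Gamma>")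
      case True
      then show ?thesis using R edge_at[OF s True] by (auto simp: lookup_scale)
    next
      case False
      then show ?thesis using v tau_closed[OF v s] by (simp add: free_space_iff lookup_scale)
    qed
  qed
qed (auto simp: lookup_scale)

text \<open>
  The ratio of the coefficients at tail and head in an eigenvector for the eigenvalue \<open>-1\<close>.
\<close>

definition sgn_weight :: "'e \<Rightarrow> Qu" where
  "sgn_weight e = (case kind \<Gamma> e of Solid \<Rightarrow> - (uu^2) | Dashed \<Rightarrow> - (uu * (uu - 1)) * inverse (uu + 1))"

text \<open>
  The coefficients at the two ends of an edge give two equations, both multiples of the equation
  that says that these coefficients are equal.
\<close>

lemma tau_ind_iff:
  assumes v: "v \<in> MM \<Gamma>" and s: "s \<in> S"
  shows "tau \<Gamma> s v = scale (uu^2) v \<longleftrightarrow>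
    (\<forall>e\<in>arcs \<Gamma>. label \<Gamma> e = s \<longrightarrow>
       Poly_Mapping.lookup v (tail \<Gamma> e) = Poly_Mapping.lookup v (head \<Gamma> e))"
proof -
  have solid: "uu^2 * b = uu^2 * a \<and> a + (uu^2 - 1) * b = uu^2 * b \<longleftrightarrow> a = b" for a b :: Qu
    using uu_neq_0 by (auto simp: algebra_simps)
  have dashed:
    "uu * a + (uu^2 - uu) * b = uu^2 * a \<and> (uu + 1) * a + (uu^2 - uu - 1) * b = uu^2 * b \<longleftrightarrow> a = b"
    for a b
  proof
    assume "uu * a + (uu^2 - uu) * b = uu^2 * a \<and> (uu + 1) * a + (uu^2 - uu - 1) * b = uu^2 * b"
    then have "uu * a + (uu^2 - uu) * b = uu^2 * a" ..
    moreover have "uu * (uu - 1) * (b - a) = (uu * a + (uu^2 - uu) * b) - uu^2 * a"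
      by (simp add: algebra_simps power2_eq_square)
    ultimately have "uu * (uu - 1) * (b - a) = 0" by simp
    then show "a = b" using uu_neq_0 uu_neq_1 by simp
  qed (simp add: algebra_simps)
  show ?thesis
    unfolding tau_eigen_iff_edges[OF v s]
  proof (rule ball_cong[OF HOL.refl], rule imp_cong[OF HOL.refl])
    fix e assume e: "e \<in> arcs \<Gamma>" "label \<Gamma> e = s"
    show "(Poly_Mapping.lookup (tau \<Gamma> s v) (tail \<Gamma> e) = uu^2 * Poly_Mapping.lookup v (tail \<Gamma> e) \<and>
       Poly_Mapping.lookup (tau \<Gamma> s v) (head \<Gamma> e) = uu^2 * Poly_Mapping.lookup v (head \<Gamma> e)) =
       (Poly_Mapping.lookup v (tail \<Gamma> e) = Poly_Mapping.lookup v (head \<Gamma> e))"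
      using lookup_tau_tail[OF v e(1)] lookup_tau_head[OF v e(1)]
      by (cases "kind \<Gamma> e") (simp_all only: edge_kind.case e(2) solid dashed)
  qed
qed

text \<open>
  Again the block of \<open>\<tau>\<^sub>s\<close> belonging to an edge has a one-dimensional eigenspace, and the two
  equations are proportional.
\<close>

lemma tau_sgn_iff:
  assumes v: "v \<in> MM \<Gamma>" and s: "s \<in> S"
  shows "tau \<Gamma> s v = scale (- 1) v \<longleftrightarrow>
    (\<forall>e\<in>arcs \<Gamma>. label \<Gamma> e = s \<longrightarrow>
       Poly_Mapping.lookup v (tail \<Gamma> e) = sgn_weight e * Poly_Mapping.lookup v (head \<Gamma> e))"
proof -
  have solid: "uu^2 * b = - 1 * a \<and> a + (uu^2 - 1) * b = - 1 * b \<longleftrightarrow> a = - (uu^2) * b" for a b :: Qu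
    by (auto simp: algebra_simps)
  have dashed:
    "uu * a + (uu^2 - uu) * b = - 1 * a \<and> (uu + 1) * a + (uu^2 - uu - 1) * b = - 1 * b
       \<longleftrightarrow> a = - (uu * (uu - 1)) * inverse (uu + 1) * b" for a b
  proof
    assume "uu * a + (uu^2 - uu) * b = - 1 * a \<and> (uu + 1) * a + (uu^2 - uu - 1) * b = - 1 * b"
    then have "uu * a + (uu^2 - uu) * b = - 1 * a" ..
    moreover have "(uu + 1) * a + uu * (uu - 1) * b = uu * a + (uu^2 - uu) * b + a"
      by (simp add: algebra_simps power2_eq_square)
    ultimately have "(uu + 1) * a = - (uu * (uu - 1)) * b" by (simp add: add_eq_0_iff)
    then have "inverse (uu + 1) * ((uu + 1) * a) = inverse (uu + 1) * (- (uu * (uu - 1)) * b)"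
      by simp
    then show "a = - (uu * (uu - 1)) * inverse (uu + 1) * b"
      using uu_add_1_neq_0 by (simp add: mult_ac)
  next
    assume a: "a = - (uu * (uu - 1)) * inverse (uu + 1) * b"
    have "(uu + 1) * a = (uu + 1) * inverse (uu + 1) * (- (uu * (uu - 1)) * b)"
      unfolding a by (simp only: mult_ac)
    then have eq: "(uu + 1) * a = - (uu * (uu - 1)) * b"
      using uu_add_1_neq_0 by simp
    moreover have "uu * a + (uu^2 - uu) * b + a = (uu + 1) * a + uu * (uu - 1) * b"
      by (simp add: algebra_simps power2_eq_square)
    ultimately have "uu * a + (uu^2 - uu) * b + a = 0" by simp
    then have "uu * a + (uu^2 - uu) * b = - 1 * a" by (metis add_eq_0_iff2 mult_minus1)
    moreover have "- (uu * (uu - 1)) * b + (uu^2 - uu - 1) * b = - 1 * b"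
      by (simp add: algebra_simps power2_eq_square)
    ultimately show "uu * a + (uu^2 - uu) * b = - 1 * a \<and> (uu + 1) * a + (uu^2 - uu - 1) * b = - 1 * b"
      unfolding eq by simp
  qed
  show ?thesis
    unfolding tau_eigen_iff_edges[OF v s]
  proof (rule ball_cong[OF HOL.refl], rule imp_cong[OF HOL.refl])
    fix e assume e: "e \<in> arcs \<Gamma>" "label \<Gamma> e = s"
    show "(Poly_Mapping.lookup (tau \<Gamma> s v) (tail \<Gamma> e) = - 1 * Poly_Mapping.lookup v (tail \<Gamma> e) \<and>
       Poly_Mapping.lookup (tau \<Gamma> s v) (head \<Gamma> e) = - 1 * Poly_Mapping.lookup v (head \<Gamma> e)) =
       (Poly_Mapping.lookup v (tail \<Gamma> e) = sgn_weight e * Poly_Mapping.lookup v (head \<Gamma> e))"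
      using lookup_tau_tail[OF v e(1)] lookup_tau_head[OF v e(1)]
      by (cases "kind \<Gamma> e") (simp_all only: sgn_weight_def edge_kind.case e(2) solid dashed)
  qed
qed

lemma sgn_weight_neq_0: "sgn_weight e \<noteq> 0"
  using uu_neq_0 uu_neq_1 uu_add_1_neq_0 by (auto simp: sgn_weight_def split: edge_kind.split)

lemma res0_sgn_weight: "res0 (sgn_weight e) 0"
proof -
  have "res0 (- (uu^2)) (- (0^2))" "res0 (- (uu * (uu - 1)) * inverse (uu + 1)) (- (0 * (0 - 1)) * 1)"
    using res0_inverse_uu_add_1 by blast+
  then show ?thesis by (auto simp: sgn_weight_def split: edge_kind.split)
qed

subsection \<open>The operators at \<open>u = 0\<close>\<close>

text \<open>
  At \<open>u = 0\<close> an edge from \<open>\<alpha>\<close> to \<open>\<beta>\<close>, solid or dashed, gives \<open>\<tau>\<^sub>s(\<alpha>) = \<beta>\<close> and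
  \<open>\<tau>\<^sub>s(\<beta>) = -\<beta>\<close>.  So, up to sign, \<open>\<tau>\<^sub>s\<close> becomes the map \<open>down s\<close> on vertices.
\<close>

definition down :: "'s \<Rightarrow> 'v \<Rightarrow> 'v" where
  "down s \<alpha> = head \<Gamma> (edge_at \<Gamma> s \<alpha>)"

lemma down_closed: "s \<in> S \<Longrightarrow> \<alpha> \<in> verts \<Gamma> \<Longrightarrow> down s \<alpha> \<in> verts \<Gamma>"
  by (simp add: down_def edge_at)

definition vec_res0 :: "('v \<Rightarrow>\<^sub>0 Qu) \<Rightarrow> ('v \<Rightarrow> rat) \<Rightarrow> bool" where
  "vec_res0 v g \<longleftrightarrow> (\<forall>\<gamma>. res0 (Poly_Mapping.lookup v \<gamma>) (g \<gamma>))"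

lemma vec_res0_tau:
  assumes v: "v \<in> MM \<Gamma>" and s: "s \<in> S" and \<alpha>: "\<alpha> \<in> verts \<Gamma>"
    and g: "vec_res0 v (\<lambda>\<gamma>. c when \<gamma> = \<alpha>)"
  shows "vec_res0 (tau \<Gamma> s v) (\<lambda>\<gamma>. (if down s \<alpha> = \<alpha> then - c else c) when \<gamma> = down s \<alpha>)"
  unfolding vec_res0_def
proof
  fix \<gamma>
  let ?c = "if down s \<alpha> = \<alpha> then - c else c"
  have r: "res0 (Poly_Mapping.lookup v x) (c when x = \<alpha>)" for x
    using g by (simp add: vec_res0_def)
  show "res0 (Poly_Mapping.lookup (tau \<Gamma> s v) \<gamma>) (?c when \<gamma> = down s \<alpha>)"
  proof (cases "\<gamma> \<in> verts \<Gamma>")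
    case False
    then have "Poly_Mapping.lookup (tau \<Gamma> s v) \<gamma> = 0" "\<gamma> \<noteq> down s \<alpha>"
      using tau_closed[OF v s] down_closed[OF s \<alpha>] by (auto simp: free_space_iff)
    then show ?thesis by simp
  next
    case True
    define e where "e = edge_at \<Gamma> s \<gamma>"
    have e: "e \<in> arcs \<Gamma>" "label \<Gamma> e = s" "tail \<Gamma> e = \<gamma> \<or> head \<Gamma> e = \<gamma>"
      using edge_at[OF s True] by (auto simp: e_def)
    have same: "edge_at \<Gamma> s \<alpha> = e" if "\<alpha> = tail \<Gamma> e \<or> \<alpha> = head \<Gamma> e"
      using edge_at_eq[OF e(1), of \<alpha>] that e(2) by auto
    have \<alpha>e: "tail \<Gamma> (edge_at \<Gamma> s \<alpha>) = \<alpha> \<or> head \<Gamma> (edge_at \<Gamma> s \<alpha>) = \<alpha>"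
      using edge_at[OF s \<alpha>] by simp
    have same': "\<alpha> = tail \<Gamma> e \<or> \<alpha> = head \<Gamma> e" if "down s \<alpha> = tail \<Gamma> e \<or> down s \<alpha> = head \<Gamma> e"
    proof -
      have "edge_at \<Gamma> s (down s \<alpha>) = edge_at \<Gamma> s \<alpha>"
        using edge_at_tail_head(2)[of "edge_at \<Gamma> s \<alpha>"] edge_at[OF s \<alpha>] by (simp add: down_def)
      moreover have "edge_at \<Gamma> s (down s \<alpha>) = e"
        using edge_at_eq[OF e(1), of "down s \<alpha>"] that e(2) by auto
      ultimately show ?thesis using \<alpha>e by auto
    qed
    let ?t = "c when tail \<Gamma> e = \<alpha>" and ?h = "c when head \<Gamma> e = \<alpha>"
    \<comment> \<open>At \<open>u = 0\<close> the coefficient of the image is \<open>0\<close> at the tail; at the head it is the difference of the coefficients at tail and head.\<close>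
    from e(3) show ?thesis
    proof
      assume \<gamma>: "tail \<Gamma> e = \<gamma>"
      have "res0 (uu^2 * Poly_Mapping.lookup v (head \<Gamma> e)) (0^2 * ?h)"
        "res0 (uu * Poly_Mapping.lookup v (tail \<Gamma> e) + (uu^2 - uu) * Poly_Mapping.lookup v (head \<Gamma> e))
          (0 * ?t + (0^2 - 0) * ?h)"
        using r by blast+
      then have "res0 (Poly_Mapping.lookup (tau \<Gamma> s v) \<gamma>) 0"
        using lookup_tau_tail[OF v e(1)] e(2) \<gamma> by (auto split: edge_kind.splits)
      moreover have "\<gamma> \<noteq> down s \<alpha>"
      proof
        assume *: "\<gamma> = down s \<alpha>"
        then have "edge_at \<Gamma> s \<alpha> = e" using same same' \<gamma> by auto
        then show False using * \<gamma> e(1) by (simp add: down_def)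
      qed
      ultimately show ?thesis by simp
    next
      assume \<gamma>: "head \<Gamma> e = \<gamma>"
      have "res0 (Poly_Mapping.lookup v (tail \<Gamma> e) + (uu^2 - 1) * Poly_Mapping.lookup v (head \<Gamma> e))
          (?t + (0^2 - 1) * ?h)"
        "res0 ((uu + 1) * Poly_Mapping.lookup v (tail \<Gamma> e) + (uu^2 - uu - 1) * Poly_Mapping.lookup v (head \<Gamma> e))
          ((0 + 1) * ?t + (0^2 - 0 - 1) * ?h)"
        using r by blast+
      then have "res0 (Poly_Mapping.lookup (tau \<Gamma> s v) \<gamma>) (?t - ?h)"
        using lookup_tau_head[OF v e(1)] e(2) \<gamma> by (auto split: edge_kind.splits)
      moreover have "?t - ?h = (?c when \<gamma> = down s \<alpha>)"
      proof (cases "\<alpha> = tail \<Gamma> e \<or> \<alpha> = head \<Gamma> e")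
        case True
        then show ?thesis using same[OF True] \<gamma> arc_simps(4,5)[OF e(1)]
          by (auto simp: down_def when_def)
      next
        case False
        then show ?thesis using same' \<gamma> by (auto simp: when_def)
      qed
      ultimately show ?thesis by simp
    qed
  qed
qed

end

section \<open>The module of a \<open>W\<close>-digraph\<close>

locale W_digraph_module = hecke_algebra W S n H + edge_labeled_digraph S \<Gamma>
  for W :: "'w monoid" and S n and H :: "('w \<Rightarrow>\<^sub>0 Qu) ring"
    and \<Gamma> :: "('v, 'e, 'w) labeled_digraph" +
  fixes \<phi> :: "('w \<Rightarrow>\<^sub>0 Qu) \<Rightarrow> ('v \<Rightarrow>\<^sub>0 Qu) \<Rightarrow> ('v \<Rightarrow>\<^sub>0 Qu)"
  assumes hom: "is_tau_hom S H \<Gamma> \<phi>"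
begin

lemma hom_End: "h \<in> carrier H \<Longrightarrow> \<phi> h \<in> carrier (End_ring (verts \<Gamma>))"
  using hom by (auto simp: is_tau_hom_def ring_hom_def)

lemma hom_closed: "h \<in> carrier H \<Longrightarrow> v \<in> MM \<Gamma> \<Longrightarrow> \<phi> h v \<in> MM \<Gamma>"
  using hom_End[of h] by (auto simp: End_ring_def)

lemma hom_linear:
  assumes "h \<in> carrier H" "v \<in> MM \<Gamma>"
  shows "w \<in> MM \<Gamma> \<Longrightarrow> \<phi> h (v + w) = \<phi> h v + \<phi> h w" "\<phi> h (scale c v) = scale c (\<phi> h v)"
  using hom_End[of h] assms by (auto simp: End_ring_def)

lemma hom_mult:
  assumes "g \<in> carrier H" "h \<in> carrier H" "v \<in> MM \<Gamma>"
  shows "\<phi> (g \<otimes>\<^bsub>H\<^esub> h) v = \<phi> g (\<phi> h v)"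
proof -
  have "\<phi> (g \<otimes>\<^bsub>H\<^esub> h) = \<phi> g \<otimes>\<^bsub>End_ring (verts \<Gamma>)\<^esub> \<phi> h"
    using hom assms by (simp add: is_tau_hom_def ring_hom_def)
  then show ?thesis using assms(3) by (simp add: End_ring_def)
qed

lemma hom_add:
  assumes "g \<in> carrier H" "h \<in> carrier H" "v \<in> MM \<Gamma>"
  shows "\<phi> (g + h) v = \<phi> g v + \<phi> h v"
proof -
  have "\<phi> (g \<oplus>\<^bsub>H\<^esub> h) = \<phi> g \<oplus>\<^bsub>End_ring (verts \<Gamma>)\<^esub> \<phi> h"
    using hom assms by (simp add: is_tau_hom_def ring_hom_def)
  then show ?thesis using assms by (simp add: End_ring_def add_H)
qed

lemma hom_one: "v \<in> MM \<Gamma> \<Longrightarrow> \<phi> (TT \<one>\<^bsub>W\<^esub>) v = v"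
proof -
  have "\<phi> \<one>\<^bsub>H\<^esub> = \<one>\<^bsub>End_ring (verts \<Gamma>)\<^esub>"
    using hom by (simp add: is_tau_hom_def ring_hom_def)
  then show "v \<in> MM \<Gamma> \<Longrightarrow> ?thesis" by (simp add: End_ring_def one_H)
qed

lemma hom_scale: "h \<in> carrier H \<Longrightarrow> v \<in> MM \<Gamma> \<Longrightarrow> \<phi> (scale c h) v = scale c (\<phi> h v)"
  using hom by (simp add: is_tau_hom_def)

lemma hom_generator: "s \<in> S \<Longrightarrow> \<phi> (TT s) = tau \<Gamma> s"
  using hom by (simp add: is_tau_hom_def)

lemma tau_linear:
  assumes "s \<in> S" "v \<in> MM \<Gamma>"
  shows "w \<in> MM \<Gamma> \<Longrightarrow> tau \<Gamma> s (v + w) = tau \<Gamma> s v + tau \<Gamma> s w"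
    "tau \<Gamma> s (scale c v) = scale c (tau \<Gamma> s v)"
  using hom_linear[of "TT s" v] assms by (auto simp: hom_generator)

lemma tau_quadratic:
  assumes "s \<in> S" "v \<in> MM \<Gamma>"
  shows "tau \<Gamma> s (tau \<Gamma> s v) = scale (uu^2) v + scale (uu^2 - 1) (tau \<Gamma> s v)"
proof -
  have "tau \<Gamma> s (tau \<Gamma> s v) = \<phi> (TT s \<otimes>\<^bsub>H\<^esub> TT s) v"
    using assms by (simp add: hom_mult hom_generator)
  also have "\<dots> = \<phi> (scale (uu^2) \<one>\<^bsub>H\<^esub>) v + \<phi> (scale (uu^2 - 1) (TT s)) v"
    using assms TT_generator_square[of s] by (simp add: hom_add)
  also have "\<dots> = scale (uu^2) v + scale (uu^2 - 1) (tau \<Gamma> s v)"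
    using assms by (simp add: hom_scale one_H hom_one hom_generator)
  finally show ?thesis .
qed

abbreviation alt_tau :: "'w \<Rightarrow> 'w \<Rightarrow> nat \<Rightarrow> ('v \<Rightarrow>\<^sub>0 Qu) \<Rightarrow> ('v \<Rightarrow>\<^sub>0 Qu)" where
  "alt_tau s t \<equiv> alternate (tau \<Gamma> s) (tau \<Gamma> t)"

lemma alt_tau_closed:
  "s \<in> S \<Longrightarrow> t \<in> S \<Longrightarrow> v \<in> MM \<Gamma> \<Longrightarrow> alt_tau s t k v \<in> MM \<Gamma>"
  by (induction k arbitrary: s t) (auto simp: tau_closed)

lemma hom_alt_elt:
  assumes "s \<in> S" "t \<in> S" "v \<in> MM \<Gamma>"
    and "\<And>j. j \<le> k \<Longrightarrow> len (alt_elt s t j) = j \<and> len (alt_elt t s j) = j"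
  shows "\<phi> (TT (alt_elt s t k)) v = alt_tau s t k v"
  using assms(1,2,4)
proof (induction k arbitrary: s t)
  case 0
  then show ?case using assms(3) by (simp add: hom_one)
next
  case (Suc k)
  have c: "alt_elt t s k \<in> carrier W" using Suc.prems by (simp add: alternate_closed)
  have "len (s \<otimes>\<^bsub>W\<^esub> alt_elt t s k) = Suc k" "len (alt_elt t s k) = k"
    using Suc.prems(3)[of "Suc k"] Suc.prems(3)[of k] by simp_all
  then have "TT (alt_elt s t (Suc k)) = TT s \<otimes>\<^bsub>H\<^esub> TT (alt_elt t s k)"
    using mult_up[of s "alt_elt t s k"] Suc.prems c by simp
  then have "\<phi> (TT (alt_elt s t (Suc k))) v = tau \<Gamma> s (\<phi> (TT (alt_elt t s k)) v)"
    using Suc.prems c assms(3) by (simp add: hom_mult hom_generator)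
  also have "\<phi> (TT (alt_elt t s k)) v = alt_tau t s k v"
    using Suc.prems by (intro Suc.IH) auto
  finally show ?case by simp
qed

text \<open>
  The length of the braid relation is written as a successor because the sign vector built from
  it needs at least one factor.
\<close>

lemma ex_tau_braid:
  assumes "s \<in> S" "t \<in> S" "n s t < \<infinity>"
  shows "\<exists>K. \<forall>v\<in>MM \<Gamma>. alt_tau s t (Suc K) v = alt_tau t s (Suc K) v"
proof -
  obtain K where K: "K \<ge> 1" "alt_elt s t K = alt_elt t s K"
    "\<And>k. k \<le> K \<Longrightarrow> len (alt_elt s t k) = k \<and> len (alt_elt t s k) = k"
    using ex_braid[OF assms] by blast
  obtain K' where K': "K = Suc K'" using K(1) by (cases K) auto
  have "alt_tau s t K v = alt_tau t s K v" if "v \<in> MM \<Gamma>" for v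
    using hom_alt_elt[OF assms(1,2) that, of K] hom_alt_elt[OF assms(2,1) that, of K] K by auto
  then show ?thesis using K' by blast
qed

text \<open>
  For \<open>c = u\<^sup>2\<close> and \<open>c = -1\<close> the linear form is \<open>ind\<close> and \<open>sgn\<close>, respectively.  The
  action of \<open>TT w\<close> is the composition of the \<open>\<tau>\<^sub>s\<close> along a reduced word of \<open>w\<close>, each of which
  contributes one factor \<open>c\<close>.
\<close>

lemma weight_space_iff_generators:
  assumes v: "v \<in> MM \<Gamma>"
  shows "(\<forall>h\<in>carrier H. \<phi> h v = scale (lin_form (\<lambda>w. c ^ len w) h) v) \<longleftrightarrow>
    (\<forall>s\<in>S. tau \<Gamma> s v = scale c v)"
proof
  assume L: "\<forall>h\<in>carrier H. \<phi> h v = scale (lin_form (\<lambda>w. c ^ len w) h) v"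
  show "\<forall>s\<in>S. tau \<Gamma> s v = scale c v"
  proof
    fix s assume s: "s \<in> S"
    then have "\<phi> (TT s) v = scale (lin_form (\<lambda>w. c ^ len w) (TT s)) v" using L by simp
    then show "tau \<Gamma> s v = scale c v" using s by (simp add: hom_generator lin_form_def)
  qed
next
  assume R: "\<forall>s\<in>S. tau \<Gamma> s v = scale c v"
  have basis: "\<phi> (TT w) v = scale (c ^ len w) v" if "w \<in> carrier W" for w
    using that
  proof (induction "len w" arbitrary: w)
    case 0
    then obtain ss where "length ss = 0" "word ss = w" using ex_reduced_word by metis
    then have "w = \<one>\<^bsub>W\<^esub>" by simp
    then show ?case using v by (simp add: hom_one poly_mapping_eq_iff fun_eq_iff lookup_scale)
  next
    case (Suc k)
    then obtain s x where x: "s \<in> S" "x \<in> carrier W" "w = s \<otimes>\<^bsub>W\<^esub> x" "len x = k"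
      using ex_left_descent[of w k] by metis
    have "\<phi> (TT w) v = tau \<Gamma> s (\<phi> (TT x) v)"
      using mult_up[of s x] x Suc.hyps(2) v hom_mult[of "TT s" "TT x" v]
      by (simp add: hom_generator)
    also have "\<phi> (TT x) v = scale (c ^ k) v" using Suc.hyps(1)[of x] x by simp
    also have "tau \<Gamma> s (scale (c ^ k) v) = scale (c ^ Suc k) v"
      using R x v by (simp add: tau_linear poly_mapping_eq_iff fun_eq_iff lookup_scale)
    finally show ?case using Suc.hyps(2) by simp
  qed
  show "\<forall>h\<in>carrier H. \<phi> h v = scale (lin_form (\<lambda>w. c ^ len w) h) v"
  proof
    fix h assume h: "h \<in> carrier H"
    have zero: "\<phi> 0 v = 0"
      using hom_scale[of "TT \<one>\<^bsub>W\<^esub>" v 0] v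
      by simp
    have sum: "(\<Sum>w\<in>F. scale (a w) (TT w)) \<in> carrier H \<and>
        \<phi> (\<Sum>w\<in>F. scale (a w) (TT w)) v = (\<Sum>w\<in>F. scale (a w) (\<phi> (TT w) v))"
      if "finite F" "F \<subseteq> carrier W" for F and a :: "'w \<Rightarrow> Qu"
      using that
    proof (induction F)
      case empty
      then show ?case using zero H.zero_closed by (simp add: zero_H)
    next
      case (insert w F)
      then have c: "scale (a w) (TT w) \<in> carrier H" "(\<Sum>w\<in>F. scale (a w) (TT w)) \<in> carrier H"
        by auto
      from H.a_closed[OF this] have "scale (a w) (TT w) + (\<Sum>w\<in>F. scale (a w) (TT w)) \<in> carrier H"
        using c by (simp add: add_H)
      then show ?case using insert c v by (simp add: hom_add hom_scale)
    qed
    let ?K = "Poly_Mapping.keys h"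
    have K: "finite ?K" "?K \<subseteq> carrier W" using h by (auto simp: carrier_H free_space_def)
    have "h = (\<Sum>w\<in>?K. scale (Poly_Mapping.lookup h w) (TT w))"
      by (rule poly_mapping_eqI)
         (auto simp: lookup_sum_poly_mapping lookup_scale lookup_single when_def in_keys_iff
           if_distrib[of "\<lambda>x. _ * x"] sum.delta cong: if_cong)
    then have "\<phi> h v = (\<Sum>w\<in>?K. scale (Poly_Mapping.lookup h w) (\<phi> (TT w) v))"
      using sum[OF K, of "Poly_Mapping.lookup h"] by simp
    also have "\<dots> = (\<Sum>w\<in>?K. scale (Poly_Mapping.lookup h w) (scale (c ^ len w) v))"
      using K by (intro sum.cong) (auto simp: basis)
    also have "\<dots> = scale (lin_form (\<lambda>w. c ^ len w) h) v"
      by (rule poly_mapping_eqI)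
         (simp add: lookup_sum_poly_mapping lookup_scale lin_form_def sum_distrib_right mult.assoc)
    finally show "\<phi> h v = scale (lin_form (\<lambda>w. c ^ len w) h) v" .
  qed
qed

section \<open>Sign vectors for two generators and local confluence\<close>

text \<open>
  Let \<open>A\<^sub>k\<close> and \<open>B\<^sub>k\<close> be the alternating products of \<open>k\<close> factors \<open>\<tau>\<^sub>s\<close>, \<open>\<tau>\<^sub>t\<close> with outermost
  factor \<open>\<tau>\<^sub>s\<close> and \<open>\<tau>\<^sub>t\<close>, respectively.  The recursion sums up to
  \<open>\<Sum>k<K. (-1)\<^sup>k u\<^sup>2\<^sup>(\<^sup>K\<^sup>-\<^sup>1\<^sup>-\<^sup>k\<^sup>) (u\<^sup>2 B\<^sub>k v - A\<^sub>k\<^sub>+\<^sub>1 v)\<close>.  If \<open>A\<^sub>K = B\<^sub>K\<close>, this is, up to the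
  factor \<open>u\<^sup>2\<^sup>K\<close>, the sum of \<open>(-1)\<^sup>l u\<^sup>-\<^sup>2\<^sup>l TT w v\<close> over the dihedral group, where \<open>l\<close> is the
  length of \<open>w\<close>.
\<close>

fun dihedral_sgn :: "'w \<Rightarrow> 'w \<Rightarrow> nat \<Rightarrow> ('v \<Rightarrow>\<^sub>0 Qu) \<Rightarrow> ('v \<Rightarrow>\<^sub>0 Qu)" where
  "dihedral_sgn s t 0 v = 0"
| "dihedral_sgn s t (Suc k) v = scale (uu^2) (dihedral_sgn s t k v) +
     scale ((- 1) ^ k) (scale (uu^2) (alt_tau t s k v) + scale (- 1) (alt_tau s t (Suc k) v))"

lemma dihedral_sgn_closed:
  "s \<in> S \<Longrightarrow> t \<in> S \<Longrightarrow> v \<in> MM \<Gamma> \<Longrightarrow> dihedral_sgn s t k v \<in> MM \<Gamma>"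
  by (induction k) (simp_all add: alt_tau_closed tau_closed)

text \<open>
  Each summand is an eigenvector by itself: \<open>\<tau>\<^sub>s B\<^sub>k = A\<^sub>k\<^sub>+\<^sub>1\<close>, and the quadratic relation gives
  \<open>\<tau>\<^sub>s A\<^sub>k\<^sub>+\<^sub>1 = u\<^sup>2 B\<^sub>k + (u\<^sup>2 - 1) A\<^sub>k\<^sub>+\<^sub>1\<close>.
\<close>

lemma tau_dihedral_sgn:
  assumes s: "s \<in> S" and t: "t \<in> S" and v: "v \<in> MM \<Gamma>"
  shows "tau \<Gamma> s (dihedral_sgn s t k v) = scale (- 1) (dihedral_sgn s t k v)"
proof (induction k)
  case 0
  have "tau \<Gamma> s (scale 0 0) = scale 0 (tau \<Gamma> s 0)" by (rule tau_linear(2)[OF s]) simp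
  then show ?case by simp
next
  case (Suc k)
  have c: "alt_tau t s k v \<in> MM \<Gamma>" "dihedral_sgn s t k v \<in> MM \<Gamma>"
    using s t v by (simp_all add: alt_tau_closed dihedral_sgn_closed)
  show ?case
    using s c tau_closed[OF c(1) s]
    by (simp add: tau_linear tau_quadratic Suc.IH)
       (simp add: poly_mapping_eq_iff fun_eq_iff lookup_scale lookup_add algebra_simps)
qed

text \<open>
  The grouping of the sum into pairs favours \<open>s\<close>.  Pairing by \<open>t\<close> instead changes it only by a
  boundary term, the difference of \<open>A\<^sub>k v\<close> and \<open>B\<^sub>k v\<close>, which vanishes when \<open>k\<close> is the length of
  a braid relation.
\<close>

lemma dihedral_sgn_swap:
  assumes s: "s \<in> S" and t: "t \<in> S" and v: "v \<in> MM \<Gamma>"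
  shows "dihedral_sgn t s k v + scale ((- 1) ^ k) (alt_tau s t k v) =
    dihedral_sgn s t k v + scale ((- 1) ^ k) (alt_tau t s k v)"
proof (induction k)
  case (Suc k)
  show ?case
  proof (rule poly_mapping_eqI)
    fix x
    let ?D = "\<lambda>s t. Poly_Mapping.lookup (dihedral_sgn s t k v) x"
    let ?A = "\<lambda>s t. Poly_Mapping.lookup (alt_tau s t k v) x"
    have "?D t s + (- 1) ^ k * ?A s t = ?D s t + (- 1) ^ k * ?A t s"
      using arg_cong[OF Suc.IH, of "\<lambda>f. Poly_Mapping.lookup f x"] by (simp add: lookup_add lookup_scale)
    then have "uu^2 * (?D t s + (- 1) ^ k * ?A s t) = uu^2 * (?D s t + (- 1) ^ k * ?A t s)"
      by simp
    then show "Poly_Mapping.lookup (dihedral_sgn t s (Suc k) v + scale ((- 1) ^ Suc k) (alt_tau s t (Suc k) v)) x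
      = Poly_Mapping.lookup (dihedral_sgn s t (Suc k) v + scale ((- 1) ^ Suc k) (alt_tau t s (Suc k) v)) x"
      by (simp add: lookup_add lookup_scale algebra_simps)
  qed
qed simp

lemma alt_tau_res0:
  assumes "s \<in> S" "t \<in> S" "\<alpha> \<in> verts \<Gamma>"
  shows "\<exists>c. (c = 1 \<or> c = - 1) \<and>
    vec_res0 (alt_tau s t k (Poly_Mapping.single \<alpha> 1)) (\<lambda>\<gamma>. c when \<gamma> = alternate (down s) (down t) k \<alpha>)"
  using assms(1,2)
proof (induction k arbitrary: s t)
  case 0
  have "vec_res0 (Poly_Mapping.single \<alpha> 1) (\<lambda>\<gamma>. 1 when \<gamma> = \<alpha>)"
    by (auto simp: vec_res0_def lookup_single when_def)
  then show ?case by auto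
next
  case (Suc k)
  let ?v = "alt_tau t s k (Poly_Mapping.single \<alpha> 1)" and ?\<beta> = "alternate (down t) (down s) k \<alpha>"
  obtain c where c: "c = 1 \<or> c = - 1" "vec_res0 ?v (\<lambda>\<gamma>. c when \<gamma> = ?\<beta>)"
    using Suc by blast
  have \<alpha>: "Poly_Mapping.single \<alpha> 1 \<in> MM \<Gamma>"
    using assms(3) by (simp add: free_space_def)
  have v: "?v \<in> MM \<Gamma>" using Suc.prems \<alpha> by (simp add: alt_tau_closed)
  have "alternate (down t) (down s) k \<alpha> \<in> verts \<Gamma>"
    using Suc.prems assms(3) by (induction k arbitrary: s t) (auto simp: down_closed)
  from vec_res0_tau[OF v Suc.prems(1) this c(2)] c(1)
  show ?case by (intro exI[of _ "if down s ?\<beta> = ?\<beta> then - c else c"]) auto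
qed

text \<open>
  All summands except the longest product carry a positive power of \<open>u\<close>.
\<close>

lemma dihedral_sgn_res0:
  assumes s: "s \<in> S" and t: "t \<in> S" and \<alpha>: "\<alpha> \<in> verts \<Gamma>"
  shows "\<exists>c. c \<noteq> 0 \<and> res0 (Poly_Mapping.lookup (dihedral_sgn s t (Suc k) (Poly_Mapping.single \<alpha> 1))
      (alternate (down s) (down t) (Suc k) \<alpha>)) c"
proof -
  let ?v = "Poly_Mapping.single \<alpha> 1 :: 'v \<Rightarrow>\<^sub>0 Qu"
  let ?\<delta> = "alternate (down s) (down t) (Suc k) \<alpha>"
  have alt: "\<exists>g. vec_res0 (alt_tau s t j ?v) g" if "s \<in> S" "t \<in> S" for s t j
    using alt_tau_res0[OF that \<alpha>] by blast
  have "\<exists>g. vec_res0 (dihedral_sgn s t j ?v) g" for j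
  proof (induction j)
    case 0
    show ?case by (auto simp: vec_res0_def intro: exI[of _ "\<lambda>_. 0"])
  next
    case (Suc j)
    then obtain g where g: "vec_res0 (dihedral_sgn s t j ?v) g" by blast
    obtain a where a: "vec_res0 (alt_tau t s j ?v) a" using alt[OF t s] by blast
    obtain b where b: "vec_res0 (alt_tau s t (Suc j) ?v) b" using alt[OF s t] by blast
    have "vec_res0 (dihedral_sgn s t (Suc j) ?v)
      (\<lambda>x. 0^2 * g x + (- 1) ^ j * (0^2 * a x + (- 1) * b x))"
      using g a b unfolding vec_res0_def dihedral_sgn.simps lookup_add lookup_scale by blast
    then show ?case by blast
  qed
  then obtain g where g: "vec_res0 (dihedral_sgn s t k ?v) g" by blast
  obtain a where a: "vec_res0 (alt_tau t s k ?v) a" using alt[OF t s] by blast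
  obtain c where c: "c = 1 \<or> c = - 1" "vec_res0 (alt_tau s t (Suc k) ?v) (\<lambda>\<gamma>. c when \<gamma> = ?\<delta>)"
    using alt_tau_res0[OF s t \<alpha>] by blast
  have "res0 (Poly_Mapping.lookup (alt_tau s t (Suc k) ?v) ?\<delta>) c"
    using c(2) unfolding vec_res0_def by (metis when_simps(1))
  then have "res0 (Poly_Mapping.lookup (dihedral_sgn s t (Suc k) ?v) ?\<delta>)
      (0^2 * g ?\<delta> + (- 1) ^ k * (0^2 * a ?\<delta> + (- 1) * c))"
    using g a unfolding vec_res0_def dihedral_sgn.simps(2) lookup_add lookup_scale by blast
  moreover have "0^2 * g ?\<delta> + (- 1) ^ k * (0^2 * a ?\<delta> + (- 1) * c) \<noteq> 0" using c(1) by auto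
  ultimately show ?thesis by blast
qed

text \<open>
  The products on both sides of the braid relation send \<open>\<alpha>\<close> to the same vector.  Its
  specialization at \<open>u = 0\<close> is a single vertex up to sign, so the two vertex maps agree at \<open>\<alpha>\<close>.
\<close>

lemma ex_dihedral_sgn_vector:
  assumes s: "s \<in> S" and t: "t \<in> S" and st: "n s t < \<infinity>" and \<alpha>: "\<alpha> \<in> verts \<Gamma>"
  shows "\<exists>K y. y \<in> MM \<Gamma> \<and> tau \<Gamma> s y = scale (- 1) y \<and> tau \<Gamma> t y = scale (- 1) y \<and>
    alternate (down s) (down t) (Suc K) \<alpha> = alternate (down t) (down s) (Suc K) \<alpha> \<and>
    Poly_Mapping.lookup y (alternate (down s) (down t) (Suc K) \<alpha>) \<noteq> 0"
proof -
  let ?v = "Poly_Mapping.single \<alpha> 1 :: 'v \<Rightarrow>\<^sub>0 Qu"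
  have v: "?v \<in> MM \<Gamma>" using \<alpha> by (simp add: free_space_def)
  obtain K where K: "alt_tau s t (Suc K) ?v = alt_tau t s (Suc K) ?v"
    using ex_tau_braid[OF s t st] v by blast
  let ?y = "dihedral_sgn s t (Suc K) ?v"
  let ?\<delta> = "alternate (down s) (down t) (Suc K) \<alpha>" and ?\<delta>' = "alternate (down t) (down s) (Suc K) \<alpha>"
  have "?y = dihedral_sgn t s (Suc K) ?v"
    using dihedral_sgn_swap[OF s t v, of "Suc K"] K
    by (simp del: dihedral_sgn.simps alternate.simps)
  then have "tau \<Gamma> t ?y = scale (- 1) ?y" using tau_dihedral_sgn[OF t s v] by metis
  moreover have "tau \<Gamma> s ?y = scale (- 1) ?y" using tau_dihedral_sgn[OF s t v] by metis
  moreover have "?\<delta> = ?\<delta>'"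
  proof -
    obtain c where c: "c = 1 \<or> c = - 1" "vec_res0 (alt_tau s t (Suc K) ?v) (\<lambda>\<gamma>. c when \<gamma> = ?\<delta>)"
      using alt_tau_res0[OF s t \<alpha>] by blast
    obtain c' where c': "c' = 1 \<or> c' = - 1" "vec_res0 (alt_tau s t (Suc K) ?v) (\<lambda>\<gamma>. c' when \<gamma> = ?\<delta>')"
      using alt_tau_res0[OF t s \<alpha>] K by metis
    have "(c when ?\<delta> = ?\<delta>) = (c' when ?\<delta> = ?\<delta>')"
      using c(2)[unfolded vec_res0_def, rule_format, of ?\<delta>]
        c'(2)[unfolded vec_res0_def, rule_format, of ?\<delta>] by (rule res0_unique)
    then show ?thesis using c(1) by (auto simp: when_def split: if_splits)
  qed
  moreover have "Poly_Mapping.lookup ?y ?\<delta> \<noteq> 0"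
    using dihedral_sgn_res0[OF s t \<alpha>, of K] res0_unique res0_0 by metis
  moreover have "?y \<in> MM \<Gamma>" using s t v by (rule dihedral_sgn_closed)
  ultimately show ?thesis by blast
qed

text \<open>
  The fourth argument is the product of the weights along a directed path whose labels lie in \<open>J\<close>.
\<close>

inductive descends :: "'w set \<Rightarrow> 'v \<Rightarrow> 'v \<Rightarrow> Qu \<Rightarrow> bool" for J where
  stay: "\<alpha> \<in> verts \<Gamma> \<Longrightarrow> descends J \<alpha> \<alpha> 1"
| step: "e \<in> arcs \<Gamma> \<Longrightarrow> label \<Gamma> e \<in> J \<Longrightarrow> descends J (head \<Gamma> e) \<gamma> c \<Longrightarrow>
    descends J (tail \<Gamma> e) \<gamma> (sgn_weight e * c)"

lemma descends_mono: "descends J \<alpha> \<gamma> c \<Longrightarrow> J \<subseteq> J' \<Longrightarrow> descends J' \<alpha> \<gamma> c"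
  by (induction rule: descends.induct) (auto intro: descends.intros)

lemma descends_trans:
  "descends J \<alpha> \<beta> c \<Longrightarrow> descends J \<beta> \<gamma> d \<Longrightarrow> descends J \<alpha> \<gamma> (c * d)"
  by (induction rule: descends.induct) (auto simp: mult.assoc intro: descends.intros)

lemma descends_sgn:
  assumes "descends J \<alpha> \<gamma> c"
    and "\<And>e. e \<in> arcs \<Gamma> \<Longrightarrow> label \<Gamma> e \<in> J \<Longrightarrow> f (tail \<Gamma> e) = sgn_weight e * f (head \<Gamma> e)"
  shows "f \<alpha> = c * f \<gamma>"
  using assms by (induction rule: descends.induct) auto

lemma descends_alternate_down:
  assumes "s \<in> S" "t \<in> S" "\<alpha> \<in> verts \<Gamma>"
  shows "\<exists>c. descends {s, t} \<alpha> (alternate (down s) (down t) k \<alpha>) c"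
  using assms(3)
proof (induction k arbitrary: \<alpha>)
  case 0
  then show ?case by (auto intro: descends.stay)
next
  case (Suc k)
  define r where "r = (if even k then s else t)"
  have r: "r \<in> S" using assms r_def by simp
  obtain c where c: "descends {s, t} (down r \<alpha>) (alternate (down s) (down t) k (down r \<alpha>)) c"
    using Suc.IH[OF down_closed[OF r Suc.prems]] by blast
  have "\<exists>c. descends {s, t} \<alpha> (alternate (down s) (down t) k (down r \<alpha>)) c"
  proof (cases "down r \<alpha> = \<alpha>")
    case True
    then show ?thesis using c by auto
  next
    case False
    note e = edge_at[OF r Suc.prems]
    have "tail \<Gamma> (edge_at \<Gamma> r \<alpha>) = \<alpha>" using e(3) False by (auto simp: down_def)
    moreover have "descends {s, t} (head \<Gamma> (edge_at \<Gamma> r \<alpha>)) (alternate (down s) (down t) k (down r \<alpha>)) c"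
      using c by (simp add: down_def[of r \<alpha>])
    ultimately show ?thesis using descends.step[OF e(1)] e(2) r_def by (metis insertCI)
  qed
  moreover have "alternate (down s) (down t) (Suc k) \<alpha> = alternate (down s) (down t) k (down r \<alpha>)"
    unfolding alternate_Suc_inner r_def by simp
  ultimately show ?case by (simp only:)
qed

text \<open>
  The innermost factors in the two sides of the braid relation are, in one order or the other,
  \<open>\<tau>\<^sub>s\<close> and \<open>\<tau>\<^sub>t\<close> with \<open>s\<close> and \<open>t\<close> the labels of \<open>e\<close> and \<open>e'\<close>; one of the two descents to the common vertex passes through the head of \<open>e\<close> and the
  other through the head of \<open>e'\<close>.  An eigenvector of both operators that is nonzero at the
  common vertex forces the two products of weights to be equal.
\<close>

lemma local_confluence:
  assumes e: "e \<in> arcs \<Gamma>" "e' \<in> arcs \<Gamma>" "tail \<Gamma> e = tail \<Gamma> e'"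
    and fin: "n (label \<Gamma> e) (label \<Gamma> e') < \<infinity>"
  shows "\<exists>\<delta> c c'. descends S (head \<Gamma> e) \<delta> c \<and> descends S (head \<Gamma> e') \<delta> c' \<and>
    sgn_weight e * c = sgn_weight e' * c'"
proof -
  define s t \<alpha> where "s = label \<Gamma> e" "t = label \<Gamma> e'" "\<alpha> = tail \<Gamma> e"
  have st: "s \<in> S" "t \<in> S" "\<alpha> \<in> verts \<Gamma>" "n s t < \<infinity>" using e fin by (auto simp: s_t_\<alpha>_def)
  obtain K y where y: "y \<in> MM \<Gamma>" "tau \<Gamma> s y = scale (- 1) y" "tau \<Gamma> t y = scale (- 1) y"
    and eq: "alternate (down s) (down t) (Suc K) \<alpha> = alternate (down t) (down s) (Suc K) \<alpha>"
    and nz: "Poly_Mapping.lookup y (alternate (down s) (down t) (Suc K) \<alpha>) \<noteq> 0"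
    using ex_dihedral_sgn_vector[OF st(1,2,4,3)] by blast
  define \<delta> where "\<delta> = alternate (down s) (down t) (Suc K) \<alpha>"
  have h: "down s \<alpha> = head \<Gamma> e" "down t \<alpha> = head \<Gamma> e'"
    using e by (auto simp: down_def s_t_\<alpha>_def) (metis edge_at_tail_head(1))
  have \<delta>1: "\<delta> = alternate (down s) (down t) K (down (if even K then s else t) \<alpha>)"
    unfolding \<delta>_def alternate_Suc_inner by (cases "even K") simp_all
  have \<delta>2: "\<delta> = alternate (down t) (down s) K (down (if even K then t else s) \<alpha>)"
    unfolding \<delta>_def eq unfolding alternate_Suc_inner by (cases "even K") simp_all
  have reach: "\<exists>c. descends {s, t} (down r \<alpha>) (alternate (down s) (down t) K (down r \<alpha>)) c"
    "\<exists>c. descends {s, t} (down r \<alpha>) (alternate (down t) (down s) K (down r \<alpha>)) c" if "r \<in> S" for r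
    using descends_alternate_down[OF st(1,2) down_closed[OF that st(3)]]
      descends_alternate_down[OF st(2,1) down_closed[OF that st(3)]] by (simp_all add: insert_commute)
  have "\<exists>c. descends {s, t} (down s \<alpha>) \<delta> c" "\<exists>c. descends {s, t} (down t \<alpha>) \<delta> c"
    using reach[OF st(1)] reach[OF st(2)] \<delta>1 \<delta>2 by (cases "even K"; simp)+
  then obtain c c' where c: "descends {s, t} (head \<Gamma> e) \<delta> c" "descends {s, t} (head \<Gamma> e') \<delta> c'"
    unfolding h by blast
  have sgn: "Poly_Mapping.lookup y (tail \<Gamma> x) = sgn_weight x * Poly_Mapping.lookup y (head \<Gamma> x)"
    if "x \<in> arcs \<Gamma>" "label \<Gamma> x \<in> {s, t}" for x
    using tau_sgn_iff[OF y(1) st(1)] tau_sgn_iff[OF y(1) st(2)] y that by auto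
  have "descends {s, t} \<alpha> \<delta> (sgn_weight e * c)" "descends {s, t} \<alpha> \<delta> (sgn_weight e' * c')"
    using descends.step[OF e(1) _ c(1)] descends.step[OF e(2) _ c(2)] e(3) by (auto simp: s_t_\<alpha>_def)
  from this[THEN descends_sgn, of "Poly_Mapping.lookup y", OF sgn]
  have "sgn_weight e * c = sgn_weight e' * c'" using nz by (simp add: \<delta>_def)
  moreover have "{s, t} \<subseteq> S" using st by simp
  ultimately show ?thesis using c descends_mono by blast
qed

end

section \<open>Connected components\<close>

text \<open>
  Connectedness of a digraph is defined through reachability inside its vertex set; the plain
  equivalence closure of the arcs is equivalent for vertices of the digraph and has a simpler
  induction rule.
\<close>

definition weakly_linked :: "('v, 'e) pre_digraph \<Rightarrow> ('v \<times> 'v) set" where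
  "weakly_linked G = ((arcs_ends G)\<^sup>s)\<^sup>*"

definition weak_classes :: "('v, 'e) pre_digraph \<Rightarrow> 'v set set" where
  "weak_classes G = (\<lambda>v. weakly_linked G `` {v}) ` verts G"

lemma weakly_linked_trans:
  "(u, v) \<in> weakly_linked G \<Longrightarrow> (v, w) \<in> weakly_linked G \<Longrightarrow> (u, w) \<in> weakly_linked G"
  by (simp add: weakly_linked_def)

lemma weakly_linked_sym: "(u, v) \<in> weakly_linked G \<Longrightarrow> (v, u) \<in> weakly_linked G"
  unfolding weakly_linked_def by (rule symD[OF sym_rtrancl]) (auto simp: symcl_def Relation.sym_def)

lemma weakly_linked_refl: "(v, v) \<in> weakly_linked G"
  by (simp add: weakly_linked_def)

lemma weakly_linked_arc:
  "e \<in> arcs G \<Longrightarrow> (tail G e, head G e) \<in> weakly_linked G"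
  unfolding weakly_linked_def by (rule r_into_rtrancl) (auto simp: symcl_def arcs_ends_conv)

lemma arc_in_symcl:
  "e \<in> arcs G \<Longrightarrow> (tail G e, head G e) \<in> (arcs_ends G)\<^sup>s \<and> (head G e, tail G e) \<in> (arcs_ends G)\<^sup>s"
  by (force simp: symcl_def arcs_ends_conv)

lemma weakly_linked_induct [consumes 1, case_names base forward backward]:
  assumes "(u, v) \<in> weakly_linked G" "P u"
    and "\<And>e. e \<in> arcs G \<Longrightarrow> P (tail G e) \<Longrightarrow> P (head G e)"
    and "\<And>e. e \<in> arcs G \<Longrightarrow> P (head G e) \<Longrightarrow> P (tail G e)"
  shows "P v"
  using assms(1) unfolding weakly_linked_def
  by (induction rule: rtrancl_induct) (use assms in \<open>auto simp: symcl_def arcs_ends_conv\<close>)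

context wf_digraph
begin

lemma connected_iff_weakly_linked:
  "connected G \<longleftrightarrow> verts G \<noteq> {} \<and> (\<forall>u\<in>verts G. \<forall>v\<in>verts G. (u, v) \<in> weakly_linked G)"
proof -
  have "(u, v) \<in> rtrancl_on (verts G) ((arcs_ends G)\<^sup>s) \<longleftrightarrow> (u, v) \<in> weakly_linked G"
    if u: "u \<in> verts G" for u v
  proof
    assume "(u, v) \<in> rtrancl_on (verts G) ((arcs_ends G)\<^sup>s)"
    then show "(u, v) \<in> weakly_linked G" unfolding weakly_linked_def
      by (induction rule: rtrancl_on_induct) auto
  next
    assume "(u, v) \<in> weakly_linked G"
    then show "(u, v) \<in> rtrancl_on (verts G) ((arcs_ends G)\<^sup>s)"
      by (induction rule: weakly_linked_induct)
         (use u arc_in_symcl[of _ G] in \<open>auto intro: rtrancl_on_into_rtrancl_on\<close>)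
  qed
  then show ?thesis unfolding connected_conv by auto
qed

lemma weakly_linked_in_verts: "(u, v) \<in> weakly_linked G \<Longrightarrow> u \<in> verts G \<Longrightarrow> v \<in> verts G"
  by (induction rule: weakly_linked_induct) auto

lemma weak_classes_eq:
  assumes "X \<in> weak_classes G" "x \<in> X"
  shows "X = weakly_linked G `` {x}"
proof -
  obtain v where X: "X = weakly_linked G `` {v}" using assms(1) by (auto simp: weak_classes_def)
  then have "(v, x) \<in> weakly_linked G" using assms(2) by simp
  note v = this weakly_linked_sym[OF this]
  show ?thesis unfolding X using v[THEN weakly_linked_trans] by auto
qed

lemma weak_class_linked_iff:
  "X \<in> weak_classes G \<Longrightarrow> x \<in> X \<Longrightarrow> (x, y) \<in> weakly_linked G \<longleftrightarrow> y \<in> X"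
  using weak_classes_eq[of X x] by auto

lemma weak_class_in_verts: "X \<in> weak_classes G \<Longrightarrow> X \<subseteq> verts G"
  using weakly_linked_in_verts by (auto simp: weak_classes_def)

lemma Union_weak_classes: "\<Union>(weak_classes G) = verts G"
proof
  show "\<Union>(weak_classes G) \<subseteq> verts G" using weak_class_in_verts by blast
  show "verts G \<subseteq> \<Union>(weak_classes G)"
  proof
    fix v assume "v \<in> verts G"
    then show "v \<in> \<Union>(weak_classes G)" using weakly_linked_refl[of v G] unfolding weak_classes_def by blast
  qed
qed

lemma weak_class_nonempty: "X \<in> weak_classes G \<Longrightarrow> X \<noteq> {}"
  unfolding weak_classes_def using weakly_linked_refl[of _ G] by blast

lemma weak_class_arc:
  assumes "X \<in> weak_classes G" "e \<in> arcs G"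
  shows "tail G e \<in> X \<longleftrightarrow> head G e \<in> X"
proof -
  note l = weakly_linked_arc[OF assms(2)]
  show ?thesis using weak_class_linked_iff[OF assms(1)] l weakly_linked_sym[OF l] by metis
qed

lemma connected_weak_class:
  assumes X: "X \<in> weak_classes G"
  shows "connected (G \<restriction> X)"
proof -
  have "(u, v) \<in> weakly_linked (G \<restriction> X)" if u: "u \<in> X" and v: "v \<in> X" for u v
  proof -
    have "(u, v) \<in> weakly_linked G" using weak_class_linked_iff[OF X u] v by simp
    then have "v \<in> X \<and> (u, v) \<in> weakly_linked (G \<restriction> X)"
    proof (induction rule: weakly_linked_induct)
      case base
      then show ?case using u by (simp add: weakly_linked_refl)
    next
      case (forward e)
      then have "(tail G e, head G e) \<in> weakly_linked (G \<restriction> X)"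
        using weakly_linked_arc[of e "G \<restriction> X"] weak_class_arc[OF X, of e] by simp
      then show ?case using forward weakly_linked_trans weak_class_arc[OF X, of e] by metis
    next
      case (backward e)
      then have "(tail G e, head G e) \<in> weakly_linked (G \<restriction> X)"
        using weakly_linked_arc[of e "G \<restriction> X"] weak_class_arc[OF X, of e] by simp
      then show ?case
        using backward weakly_linked_trans weakly_linked_sym weak_class_arc[OF X, of e] by metis
    qed
    then show ?thesis ..
  qed
  moreover have "X \<noteq> {}" by (rule weak_class_nonempty[OF X])
  ultimately show ?thesis
    using wf_digraph.connected_iff_weakly_linked[OF wellformed_induce_subgraph[of X]] by simp
qed

text \<open>
  Together with the connectedness of the induced subgraphs on the classes, this identifies these
  subgraphs as the maximal connected ones.
\<close>

lemma connected_subgraph_in_weak_class: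
  assumes H: "subgraph H G" "connected H" "v \<in> verts H"
  shows "subgraph H (G \<restriction> (weakly_linked G `` {v}))"
proof -
  have wf: "wf_digraph H" using H(1) by auto
  have mono: "weakly_linked H \<subseteq> weakly_linked G"
    unfolding weakly_linked_def by (rule rtrancl_mono) (use arcs_ends_mono[OF H(1)] in \<open>auto simp: symcl_def\<close>)
  have sub: "verts H \<subseteq> weakly_linked G `` {v}"
    using H(2,3) mono wf_digraph.connected_iff_weakly_linked[OF wf] by auto
  have "arcs H \<subseteq> arcs G" "tail H = tail G" "head H = head G"
    using H(1) by (auto simp: subgraph_def compatible_def)
  then show ?thesis
    using sub wf wf_digraph.wellformed[OF wf] wellformed_induce_subgraph
    by (fastforce simp: subgraph_def compatible_def)
qed

lemma components_eq_weak_classes: "components G = (\<lambda>X. G \<restriction> X) ` weak_classes G"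
proof (intro equalityI subsetI)
  fix C assume "C \<in> components G"
  then have C: "max_subgraph connected C" by (simp add: components_def)
  then have sub: "subgraph C G" "connected C" by (auto simp: max_subgraph_def)
  then obtain v where v: "v \<in> verts C"
    using wf_digraph.connected_iff_weakly_linked[of C] by auto
  let ?X = "weakly_linked G `` {v}"
  have X: "?X \<in> weak_classes G" using v sub by (auto simp: weak_classes_def)
  have "subgraph (G \<restriction> ?X) G" by (rule subgraph_induce_subgraphI[OF weak_class_in_verts[OF X]])
  then have "G \<restriction> ?X = C"
    using C connected_subgraph_in_weak_class[OF sub v] connected_weak_class[OF X]
    unfolding max_subgraph_def by blast
  then show "C \<in> (\<lambda>X. G \<restriction> X) ` weak_classes G" using X by blast
next
  fix C assume "C \<in> (\<lambda>X. G \<restriction> X) ` weak_classes G"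
  then obtain X where X: "X \<in> weak_classes G" "C = G \<restriction> X" by blast
  then obtain v where v: "v \<in> X" using weak_class_nonempty by blast
  have "max_subgraph connected (G \<restriction> X)"
  proof (rule max_subgraphI)
    show "connected (G \<restriction> X)" by (rule connected_weak_class[OF X(1)])
    show "subgraph (G \<restriction> X) G" by (rule subgraph_induce_subgraphI[OF weak_class_in_verts[OF X(1)]])
    fix H assume H: "G \<restriction> X \<noteq> H" "subgraph (G \<restriction> X) H" "subgraph H G"
    show "\<not> connected H"
    proof
      assume "connected H"
      moreover have "v \<in> verts H" using H(2) v by (auto simp: subgraph_def)
      ultimately have "subgraph H (G \<restriction> X)"
        using connected_subgraph_in_weak_class[OF H(3)] weak_classes_eq[OF X(1) v] by metis
      then have "G \<restriction> X = H" using H(2)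
        by (intro pre_digraph.equality) (auto simp: subgraph_def compatible_def)
      then show False using H(1) by blast
    qed
  qed
  then show "C \<in> components G" by (simp add: components_def X(2))
qed

text \<open>
  A directed walk cannot leave its class, so circuits of a component are the same as circuits of
  the whole digraph that start in the component.
\<close>

lemma acyclic_weak_class_iff:
  assumes X: "X \<in> weak_classes G"
  shows "acyclic_digraph (G \<restriction> X) \<longleftrightarrow> (\<forall>x\<in>X. (x, x) \<notin> (arcs_ends G)\<^sup>+)"
proof -
  interpret C: wf_digraph "G \<restriction> X" by (rule wellformed_induce_subgraph)
  have sub: "arcs_ends (G \<restriction> X) \<subseteq> arcs_ends G" by (auto simp: arcs_ends_conv)
  have "y \<in> X \<and> (x, y) \<in> (arcs_ends (G \<restriction> X))\<^sup>+" if "(x, y) \<in> (arcs_ends G)\<^sup>+" "x \<in> X" for x y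
    using that
  proof (induction rule: trancl_induct)
    case (base y)
    then show ?case using weak_class_arc[OF X] by (auto simp: arcs_ends_conv)
  next
    case (step y z)
    then have "z \<in> X \<and> (y, z) \<in> arcs_ends (G \<restriction> X)"
      using weak_class_arc[OF X] by (auto simp: arcs_ends_conv)
    then show ?case using step by (meson trancl.trancl_into_trancl)
  qed
  moreover have "x \<in> X" if "(x, x) \<in> (arcs_ends (G \<restriction> X))\<^sup>+" for x
    using tranclD[OF that] by (auto simp: arcs_ends_conv)
  ultimately have "(\<exists>x. (x, x) \<in> (arcs_ends (G \<restriction> X))\<^sup>+) \<longleftrightarrow> (\<exists>x\<in>X. (x, x) \<in> (arcs_ends G)\<^sup>+)"
    using trancl_mono_subset[OF sub] by blast
  then show ?thesis unfolding acyclic_digraph_def C.reachable1_awalk by auto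
qed

end

section \<open>Dimensions of the eigenspaces\<close>

interpretation Qu: vector_space scale by (rule vector_space_scale)

text \<open>
  The restrictions of \<open>f\<close> to the classes are linearly independent because their supports are
  disjoint and nonempty, and they span \<open>V\<close> because every vector in \<open>V\<close> is proportional to \<open>f\<close>
  on each class.
\<close>

lemma dim_eq_card_classes:
  fixes P :: "'b set set" and f :: "'b \<Rightarrow> Qu" and V :: "('b \<Rightarrow>\<^sub>0 Qu) set"
  assumes fin: "finite P" "\<And>X. X \<in> P \<Longrightarrow> finite X"
    and part: "\<And>X. X \<in> P \<Longrightarrow> X \<noteq> {}" "disjoint P"
    and f: "\<And>x. x \<in> \<Union>P \<Longrightarrow> f x \<noteq> 0"
    and basis_in: "\<And>X. X \<in> P \<Longrightarrow> (\<Sum>x\<in>X. Poly_Mapping.single x (f x)) \<in> V"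
    and supp: "\<And>v x. v \<in> V \<Longrightarrow> x \<notin> \<Union>P \<Longrightarrow> Poly_Mapping.lookup v x = 0"
    and ratio: "\<And>v X x y. v \<in> V \<Longrightarrow> X \<in> P \<Longrightarrow> x \<in> X \<Longrightarrow> y \<in> X \<Longrightarrow>
      Poly_Mapping.lookup v x * f y = Poly_Mapping.lookup v y * f x"
  shows "Qu.dim V = card P"
proof -
  define b where "b X = (\<Sum>x\<in>X. Poly_Mapping.single x (f x))" for X
  have lookup_b: "Poly_Mapping.lookup (b X) x = (if x \<in> X then f x else 0)" if "X \<in> P" for X x
    using fin(2)[OF that] by (simp add: b_def lookup_sum_poly_mapping lookup_single when_def)
  have eqX: "X = Y" if "X \<in> P" "Y \<in> P" "x \<in> X" "x \<in> Y" for X Y x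
    using part(2) that by (auto simp: disjoint_def)
  define r where "r X = (SOME x. x \<in> X)" for X :: "'b set"
  have r: "r X \<in> X" if "X \<in> P" for X using part(1)[OF that] unfolding r_def by (simp add: some_in_eq)
  have lookup_sum: "Poly_Mapping.lookup (\<Sum>X\<in>P. scale (c X) (b X)) x = c Y * f x"
    if "Y \<in> P" "x \<in> Y" for c x Y
  proof -
    have "Poly_Mapping.lookup (\<Sum>X\<in>P. scale (c X) (b X)) x = (\<Sum>X\<in>P. if X = Y then c Y * f x else 0)"
      unfolding lookup_sum_poly_mapping lookup_scale
      using that eqX by (intro sum.cong) (auto simp: lookup_b)
    then show ?thesis using fin(1) that by simp
  qed
  have inj: "inj_on b P"
  proof (rule inj_onI)
    fix X Y assume XY: "X \<in> P" "Y \<in> P" "b X = b Y"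
    then have "Poly_Mapping.lookup (b Y) (r X) \<noteq> 0" using r f by (auto simp: lookup_b simp flip: XY(3))
    then show "X = Y" using XY eqX[of X Y "r X"] r by (auto simp: lookup_b split: if_splits)
  qed
  have "V \<subseteq> Qu.span (b ` P)"
  proof
    fix v assume v: "v \<in> V"
    let ?c = "\<lambda>X. Poly_Mapping.lookup v (r X) / f (r X)"
    have "v = (\<Sum>X\<in>P. scale (?c X) (b X))"
    proof (rule poly_mapping_eqI)
      fix x
      show "Poly_Mapping.lookup v x = Poly_Mapping.lookup (\<Sum>X\<in>P. scale (?c X) (b X)) x"
      proof (cases "x \<in> \<Union>P")
        case True
        then obtain Y where Y: "Y \<in> P" "x \<in> Y" by blast
        then have "f (r Y) \<noteq> 0" using f r by blast
        then show ?thesis using ratio[OF v Y(1,2) r[OF Y(1)]]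
          unfolding lookup_sum[OF Y] by (simp add: field_simps)
      next
        case False
        then have "Poly_Mapping.lookup (\<Sum>X\<in>P. scale (?c X) (b X)) x = 0"
          unfolding lookup_sum_poly_mapping lookup_scale by (intro sum.neutral) (auto simp: lookup_b)
        then show ?thesis using supp[OF v False] by simp
      qed
    qed
    also have "\<dots> \<in> Qu.span (b ` P)"
      by (intro Qu.span_sum Qu.span_scale Qu.span_base) auto
    finally show "v \<in> Qu.span (b ` P)" .
  qed
  moreover have "Qu.independent (b ` P)"
  proof (rule Qu.independent_if_scalars_zero)
    show "finite (b ` P)" using fin(1) by simp
    fix c g assume sum: "(\<Sum>g\<in>b ` P. scale (c g) g) = 0" and g: "g \<in> b ` P"
    then obtain Y where Y: "Y \<in> P" "g = b Y" by blast
    have "(\<Sum>X\<in>P. scale (c (b X)) (b X)) = 0" using sum inj by (simp add: sum.reindex)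
    then have "c (b Y) * f (r Y) = 0" using lookup_sum[OF Y(1) r[OF Y(1)], of "\<lambda>X. c (b X)"] by simp
    then show "c g = 0" using f r Y by auto
  qed
  moreover have "b ` P \<subseteq> V" using basis_in by (auto simp: b_def)
  ultimately have "card (b ` P) = Qu.dim V"
    by (intro Qu.basis_card_eq_dim) auto
  then show ?thesis using card_image[OF inj] by simp
qed

context edge_labeled_digraph
begin

sublocale G: wf_digraph "underlying \<Gamma>"
  using loopfree by (simp add: loopfree_digraph_def)

lemma linked_constant:
  assumes "\<forall>e\<in>arcs \<Gamma>. f (tail \<Gamma> e) = f (head \<Gamma> e)" "(x, y) \<in> weakly_linked (underlying \<Gamma>)"
  shows "f x = f y"
  using assms(2) by (induction rule: weakly_linked_induct) (use assms(1) in auto)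

definition acyclic_classes :: "'v set set" where
  "acyclic_classes = {X \<in> weak_classes (underlying \<Gamma>). \<forall>x\<in>X. (x, x) \<notin> (arcs_ends (underlying \<Gamma>))\<^sup>+}"

lemma disjoint_weak_classes: "disjoint (weak_classes (underlying \<Gamma>))"
  unfolding disjoint_def disjoint_iff using G.weak_classes_eq by metis

lemma card_components: "card (components (underlying \<Gamma>)) = card (weak_classes (underlying \<Gamma>))"
  unfolding G.components_eq_weak_classes by (rule card_image) (metis inj_onI induce_subgraph_verts)

lemma card_acyclic_components:
  "card {C \<in> components (underlying \<Gamma>). acyclic_digraph C} = card acyclic_classes"
proof -
  have "{C \<in> components (underlying \<Gamma>). acyclic_digraph C} = (\<lambda>X. underlying \<Gamma> \<restriction> X) ` acyclic_classes"
    unfolding G.components_eq_weak_classes acyclic_classes_def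
    using G.acyclic_weak_class_iff by blast
  then show ?thesis by (simp add: card_image inj_on_def) (metis card_image inj_onI induce_subgraph_verts)
qed

lemma finite_classes:
  assumes "finite (verts \<Gamma>)"
  shows "finite (weak_classes (underlying \<Gamma>))" "X \<in> weak_classes (underlying \<Gamma>) \<Longrightarrow> finite X"
  using assms G.weak_class_in_verts[of X] by (auto simp: weak_classes_def intro: finite_subset)

definition ind_vectors :: "('v \<Rightarrow>\<^sub>0 Qu) set" where
  "ind_vectors = {v \<in> MM \<Gamma>. \<forall>e\<in>arcs \<Gamma>. Poly_Mapping.lookup v (tail \<Gamma> e) = Poly_Mapping.lookup v (head \<Gamma> e)}"

definition sgn_vectors :: "('v \<Rightarrow>\<^sub>0 Qu) set" where
  "sgn_vectors = {v \<in> MM \<Gamma>. \<forall>e\<in>arcs \<Gamma>.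
     Poly_Mapping.lookup v (tail \<Gamma> e) = sgn_weight e * Poly_Mapping.lookup v (head \<Gamma> e)}"

lemma ind_vectors_eq_eigenspace:
  "{v \<in> MM \<Gamma>. \<forall>s\<in>S. tau \<Gamma> s v = scale (uu^2) v} = ind_vectors"
proof -
  have "(\<forall>s\<in>S. tau \<Gamma> s v = scale (uu^2) v) \<longleftrightarrow>
      (\<forall>e\<in>arcs \<Gamma>. Poly_Mapping.lookup v (tail \<Gamma> e) = Poly_Mapping.lookup v (head \<Gamma> e))"
    (is "_ \<longleftrightarrow> ?edges") if v: "v \<in> MM \<Gamma>" for v
  proof -
    have "(\<forall>s\<in>S. tau \<Gamma> s v = scale (uu^2) v) \<longleftrightarrow> (\<forall>s\<in>S. \<forall>e\<in>arcs \<Gamma>. label \<Gamma> e = s \<longrightarrow>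
        Poly_Mapping.lookup v (tail \<Gamma> e) = Poly_Mapping.lookup v (head \<Gamma> e))"
      by (rule ball_cong[OF HOL.refl tau_ind_iff[OF v]])
    also have "\<dots> \<longleftrightarrow> ?edges" using arc_simps(3) by blast
    finally show ?thesis .
  qed
  then show ?thesis unfolding ind_vectors_def by blast
qed

lemma sgn_vectors_eq_eigenspace:
  "{v \<in> MM \<Gamma>. \<forall>s\<in>S. tau \<Gamma> s v = scale (- 1) v} = sgn_vectors"
proof -
  have "(\<forall>s\<in>S. tau \<Gamma> s v = scale (- 1) v) \<longleftrightarrow>
      (\<forall>e\<in>arcs \<Gamma>. Poly_Mapping.lookup v (tail \<Gamma> e) = sgn_weight e * Poly_Mapping.lookup v (head \<Gamma> e))"
    (is "_ \<longleftrightarrow> ?edges") if v: "v \<in> MM \<Gamma>" for v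
  proof -
    have "(\<forall>s\<in>S. tau \<Gamma> s v = scale (- 1) v) \<longleftrightarrow> (\<forall>s\<in>S. \<forall>e\<in>arcs \<Gamma>. label \<Gamma> e = s \<longrightarrow>
        Poly_Mapping.lookup v (tail \<Gamma> e) = sgn_weight e * Poly_Mapping.lookup v (head \<Gamma> e))"
      by (rule ball_cong[OF HOL.refl tau_sgn_iff[OF v]])
    also have "\<dots> \<longleftrightarrow> ?edges" using arc_simps(3) by blast
    finally show ?thesis .
  qed
  then show ?thesis unfolding sgn_vectors_def by blast
qed

lemma lookup_sum_single:
  "finite X \<Longrightarrow> Poly_Mapping.lookup (\<Sum>x\<in>X. Poly_Mapping.single x (f x)) y = (if y \<in> X then f y else 0)"
  by (simp add: lookup_sum_poly_mapping lookup_single when_def)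

lemma dim_ind_vectors:
  assumes fin: "finite (verts \<Gamma>)"
  shows "Qu.dim ind_vectors = card (weak_classes (underlying \<Gamma>))"
proof (rule dim_eq_card_classes[where f = "\<lambda>_. 1"])
  fix X assume X: "X \<in> weak_classes (underlying \<Gamma>)"
  show "(\<Sum>x\<in>X. TT x) \<in> ind_vectors"
    using G.weak_class_in_verts[OF X] G.weak_class_arc[OF X]
    by (auto simp: ind_vectors_def free_space_iff lookup_sum_single[OF finite_classes(2)[OF fin X]])
next
  fix v X x y assume "v \<in> ind_vectors" and X: "X \<in> weak_classes (underlying \<Gamma>)" "x \<in> X" "y \<in> X"
  moreover have "(x, y) \<in> weakly_linked (underlying \<Gamma>)" using G.weak_class_linked_iff[OF X(1,2)] X(3) by simp
  ultimately have "Poly_Mapping.lookup v x = Poly_Mapping.lookup v y"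
    unfolding ind_vectors_def by (intro linked_constant[where f = "Poly_Mapping.lookup v"]) auto
  then show "Poly_Mapping.lookup v x * 1 = Poly_Mapping.lookup v y * 1" by simp
next
  show "Poly_Mapping.lookup v x = 0" if "v \<in> ind_vectors" "x \<notin> \<Union>(weak_classes (underlying \<Gamma>))" for v x
    using that by (simp add: ind_vectors_def free_space_iff G.Union_weak_classes)
qed (use fin finite_classes disjoint_weak_classes G.weak_class_nonempty in auto)

lemma sgn_vector_trancl:
  assumes "v \<in> sgn_vectors" "(x, y) \<in> (arcs_ends (underlying \<Gamma>))\<^sup>+"
  shows "\<exists>c. res0 c 0 \<and> Poly_Mapping.lookup v x = c * Poly_Mapping.lookup v y"
  using assms(2)
proof (induction rule: trancl_induct)
  case (base y)
  then obtain e where "e \<in> arcs \<Gamma>" "x = tail \<Gamma> e" "y = head \<Gamma> e" by (auto simp: arcs_ends_conv)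
  then show ?case using assms(1) res0_sgn_weight by (auto simp: sgn_vectors_def)
next
  case (step y z)
  then obtain e where e: "e \<in> arcs \<Gamma>" "y = tail \<Gamma> e" "z = head \<Gamma> e" by (auto simp: arcs_ends_conv)
  obtain c where c: "res0 c 0" "Poly_Mapping.lookup v x = c * Poly_Mapping.lookup v y"
    using step.IH by blast
  have "res0 (c * sgn_weight e) (0 * 0)" using c(1) res0_sgn_weight by blast
  moreover have "Poly_Mapping.lookup v x = c * sgn_weight e * Poly_Mapping.lookup v z"
    using c(2) e assms(1) by (simp add: sgn_vectors_def)
  ultimately show ?case by auto
qed

text \<open>
  Around a circuit the coefficient at \<open>x\<close> equals itself times a product of weights, which has
  value \<open>0\<close> at \<open>u = 0\<close> and so is not \<open>1\<close>.  The weights are nonzero, which spreads the vanishing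
  of the coefficient from \<open>x\<close> to its whole component.
\<close>

lemma sgn_vector_circuit:
  assumes v: "v \<in> sgn_vectors" and x: "(x, x) \<in> (arcs_ends (underlying \<Gamma>))\<^sup>+"
    and y: "(x, y) \<in> weakly_linked (underlying \<Gamma>)"
  shows "Poly_Mapping.lookup v y = 0"
  using y
proof (induction rule: weakly_linked_induct)
  case base
  obtain c where c: "res0 c 0" "Poly_Mapping.lookup v x = c * Poly_Mapping.lookup v x"
    using sgn_vector_trancl[OF v x] by blast
  have "c \<noteq> 1" using res0_unique[OF c(1)] res0_1 by fastforce
  then show ?case using c(2) by simp
next
  case (forward e)
  then show ?case using v sgn_weight_neq_0[of e] by (auto simp: sgn_vectors_def)
next
  case (backward e)
  then show ?case using v by (auto simp: sgn_vectors_def)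
qed

text \<open>
  The function \<open>f\<close> is a nowhere vanishing solution of the edge conditions on the acyclic
  components; its existence is the content of the confluence argument.
\<close>

lemma dim_sgn_vectors_of_potential:
  assumes fin: "finite (verts \<Gamma>)"
    and f: "\<And>x. x \<in> \<Union>acyclic_classes \<Longrightarrow> f x \<noteq> 0"
      "\<And>e. e \<in> arcs \<Gamma> \<Longrightarrow> tail \<Gamma> e \<in> \<Union>acyclic_classes \<Longrightarrow> f (tail \<Gamma> e) = sgn_weight e * f (head \<Gamma> e)"
  shows "Qu.dim sgn_vectors = card acyclic_classes"
proof (rule dim_eq_card_classes[where f = f])
  have sub: "acyclic_classes \<subseteq> weak_classes (underlying \<Gamma>)" by (auto simp: acyclic_classes_def)
  then show "finite acyclic_classes" "disjoint acyclic_classes"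
    using finite_classes(1)[OF fin] disjoint_weak_classes
    by (auto intro: finite_subset simp: pairwise_subset)
  show "finite X" "X \<noteq> {}" if "X \<in> acyclic_classes" for X
    using that sub finite_classes(2)[OF fin] G.weak_class_nonempty by auto
  show "(\<Sum>x\<in>X. Poly_Mapping.single x (f x)) \<in> sgn_vectors" if "X \<in> acyclic_classes" for X
  proof -
    have X: "X \<in> weak_classes (underlying \<Gamma>)" using that sub by blast
    show ?thesis
      using G.weak_class_in_verts[OF X] G.weak_class_arc[OF X] f(2) that
      by (auto simp: sgn_vectors_def free_space_iff lookup_sum_single[OF finite_classes(2)[OF fin X]])
  qed
  show "Poly_Mapping.lookup v x = 0" if v: "v \<in> sgn_vectors" and x: "x \<notin> \<Union>acyclic_classes" for v x
  proof (cases "x \<in> verts \<Gamma>")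
    case True
    then obtain X where X: "X \<in> weak_classes (underlying \<Gamma>)" "x \<in> X"
      using G.Union_weak_classes by auto
    then obtain y where y: "y \<in> X" "(y, y) \<in> (arcs_ends (underlying \<Gamma>))\<^sup>+"
      using x by (auto simp: acyclic_classes_def)
    show ?thesis using sgn_vector_circuit[OF v y(2)] G.weak_class_linked_iff[OF X(1) y(1)] X(2) by simp
  next
    case False
    then show ?thesis using v by (simp add: sgn_vectors_def free_space_iff)
  qed
  show "Poly_Mapping.lookup v x * f y = Poly_Mapping.lookup v y * f x"
    if v: "v \<in> sgn_vectors" and X: "X \<in> acyclic_classes" "x \<in> X" "y \<in> X" for v X x y
  proof -
    have X': "X \<in> weak_classes (underlying \<Gamma>)" using X(1) sub by blast
    have ratio: "Poly_Mapping.lookup v (tail \<Gamma> e) / f (tail \<Gamma> e) = Poly_Mapping.lookup v (head \<Gamma> e) / f (head \<Gamma> e)"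
      if e: "e \<in> arcs \<Gamma>" "tail \<Gamma> e \<in> X" for e
    proof -
      have "f (tail \<Gamma> e) = sgn_weight e * f (head \<Gamma> e)" using f(2)[OF e(1)] e(2) X(1) by blast
      moreover have "Poly_Mapping.lookup v (tail \<Gamma> e) = sgn_weight e * Poly_Mapping.lookup v (head \<Gamma> e)"
        using v e(1) by (simp add: sgn_vectors_def)
      ultimately show ?thesis using sgn_weight_neq_0[of e] by simp
    qed
    have "(x, y) \<in> weakly_linked (underlying \<Gamma>)" using G.weak_class_linked_iff[OF X' X(2)] X(3) by simp
    then have "y \<in> X \<and> Poly_Mapping.lookup v y / f y = Poly_Mapping.lookup v x / f x"
    proof (induction rule: weakly_linked_induct)
      case base
      then show ?case using X by simp
    next
      case (forward e)
      then show ?case using ratio[of e] G.weak_class_arc[OF X', of e] by simp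
    next
      case (backward e)
      then show ?case using ratio[of e] G.weak_class_arc[OF X', of e] by simp
    qed
    moreover have "f x \<noteq> 0" "f y \<noteq> 0" using f(1) X by auto
    ultimately show ?thesis by (simp add: field_simps)
  qed
qed (use f in auto)

end

section \<open>Unique sinks in acyclic components\<close>

context W_digraph_module
begin

definition sink :: "'v \<Rightarrow> bool" where
  "sink \<gamma> \<longleftrightarrow> \<gamma> \<notin> tail \<Gamma> ` arcs \<Gamma>"

lemma descends_neq_0: "descends J \<alpha> \<gamma> c \<Longrightarrow> c \<noteq> 0"
  by (induction rule: descends.induct) (auto simp: sgn_weight_neq_0)

lemma descends_to_sink_cases:
  assumes "descends S \<alpha> \<gamma> c" "sink \<gamma>"
  shows "(sink \<alpha> \<and> \<gamma> = \<alpha> \<and> c = 1) \<or>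
    (\<exists>e\<in>arcs \<Gamma>. \<exists>d. tail \<Gamma> e = \<alpha> \<and> descends S (head \<Gamma> e) \<gamma> d \<and> c = sgn_weight e * d)"
  using assms by (cases rule: descends.cases) auto

lemma acyclic_classes_closed:
  "e \<in> arcs \<Gamma> \<Longrightarrow> tail \<Gamma> e \<in> \<Union>acyclic_classes \<longleftrightarrow> head \<Gamma> e \<in> \<Union>acyclic_classes"
  using G.weak_class_arc by (auto simp: acyclic_classes_def)

lemma descends_closed:
  "descends J \<alpha> \<gamma> c \<Longrightarrow> \<alpha> \<in> \<Union>acyclic_classes \<Longrightarrow> \<gamma> \<in> \<Union>acyclic_classes"
  by (induction rule: descends.induct) (simp_all only: acyclic_classes_closed)

text \<open>
  On the finitely many vertices of acyclic components the converse of the arc relation is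
  well-founded.
\<close>

lemma acyclic_classes_induct:
  assumes fin: "finite (verts \<Gamma>)" and \<alpha>: "\<alpha> \<in> \<Union>acyclic_classes"
    and step: "\<And>\<alpha>. \<alpha> \<in> verts \<Gamma> \<Longrightarrow> \<alpha> \<in> \<Union>acyclic_classes \<Longrightarrow>
      (\<And>e. e \<in> arcs \<Gamma> \<Longrightarrow> tail \<Gamma> e = \<alpha> \<Longrightarrow> P (head \<Gamma> e)) \<Longrightarrow> P \<alpha>"
  shows "P \<alpha>"
proof -
  let ?A = "\<Union>acyclic_classes" and ?E = "arcs_ends (underlying \<Gamma>)"
  let ?R = "{(x, y) \<in> ?E. x \<in> ?A}"
  have "?R \<subseteq> verts \<Gamma> \<times> verts \<Gamma>" by (auto simp: arcs_ends_conv)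
  then have "finite ?R" using fin by (meson finite_SigmaI finite_subset)
  moreover have "acyclic ?R"
  proof (rule acyclicI, rule allI, rule notI)
    fix x assume x: "(x, x) \<in> ?R\<^sup>+"
    then have "x \<in> ?A" by (auto dest: tranclD)
    moreover have "(x, x) \<in> ?E\<^sup>+" using x by (rule trancl_mono) auto
    ultimately show False by (auto simp: acyclic_classes_def)
  qed
  ultimately have "wf (?R\<inverse>)" by (rule finite_acyclic_wf_converse)
  then show ?thesis using \<alpha>
  proof (induction \<alpha> rule: wf_induct_rule)
    case (less \<alpha>)
    show ?case
    proof (rule step)
      show "\<alpha> \<in> verts \<Gamma>"
        using less.prems G.weak_class_in_verts by (fastforce simp: acyclic_classes_def)
      show "P (head \<Gamma> e)" if e: "e \<in> arcs \<Gamma>" "tail \<Gamma> e = \<alpha>" for e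
      proof (rule less.IH)
        show "(head \<Gamma> e, \<alpha>) \<in> ?R\<inverse>" using e less.prems by (auto simp: arcs_ends_conv)
        show "head \<Gamma> e \<in> ?A" using acyclic_classes_closed[OF e(1)] e(2) less.prems by simp
      qed
    qed (fact less.prems)
  qed
qed

lemma ex_sink:
  assumes "finite (verts \<Gamma>)" "\<alpha> \<in> \<Union>acyclic_classes"
  shows "\<exists>\<gamma> c. sink \<gamma> \<and> descends S \<alpha> \<gamma> c"
  using assms
proof (rule acyclic_classes_induct)
  fix \<alpha> assume \<alpha>: "\<alpha> \<in> verts \<Gamma>"
    and IH: "\<And>e. e \<in> arcs \<Gamma> \<Longrightarrow> tail \<Gamma> e = \<alpha> \<Longrightarrow> \<exists>\<gamma> c. sink \<gamma> \<and> descends S (head \<Gamma> e) \<gamma> c"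
  show "\<exists>\<gamma> c. sink \<gamma> \<and> descends S \<alpha> \<gamma> c"
  proof (cases "sink \<alpha>")
    case True
    then show ?thesis using descends.stay[OF \<alpha>] by blast
  next
    case False
    then obtain e where e: "e \<in> arcs \<Gamma>" "tail \<Gamma> e = \<alpha>" by (auto simp: sink_def)
    then show ?thesis using IH[OF e] descends.step[OF e(1), of S] by (metis arc_simps(3))
  qed
qed

text \<open>
  If \<open>\<alpha>\<close> is not a sink, the two descents start with edges \<open>e\<close> and \<open>e'\<close>.  Local confluence joins
  their heads in a vertex \<open>\<delta>\<close>, which descends to some sink \<open>\<epsilon>\<close>.  The induction hypothesis at
  either head compares the given descent with the one through \<open>\<delta>\<close>.
\<close>

lemma unique_sink:
  assumes fin: "finite (verts \<Gamma>)" and n_fin: "\<forall>s\<in>S. \<forall>t\<in>S. n s t < \<infinity>"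
    and \<alpha>: "\<alpha> \<in> \<Union>acyclic_classes"
    and sinks: "sink \<gamma>" "sink \<gamma>'" "descends S \<alpha> \<gamma> c" "descends S \<alpha> \<gamma>' c'"
  shows "\<gamma> = \<gamma>' \<and> c = c'"
proof -
  let ?P = "\<lambda>\<alpha>. \<forall>\<gamma> c \<gamma>' c'. sink \<gamma> \<and> sink \<gamma>' \<and> descends S \<alpha> \<gamma> c \<and> descends S \<alpha> \<gamma>' c' \<longrightarrow> \<gamma> = \<gamma>' \<and> c = c'"
  have "?P \<alpha>" using fin \<alpha>
  proof (rule acyclic_classes_induct, intro allI impI, elim conjE)
    fix \<alpha> \<gamma> c \<gamma>' c'
    assume \<alpha>: "\<alpha> \<in> \<Union>acyclic_classes"
      and IH: "\<And>e. e \<in> arcs \<Gamma> \<Longrightarrow> tail \<Gamma> e = \<alpha> \<Longrightarrow> ?P (head \<Gamma> e)"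
      and \<gamma>: "sink \<gamma>" "descends S \<alpha> \<gamma> c" and \<gamma>': "sink \<gamma>'" "descends S \<alpha> \<gamma>' c'"
    show "\<gamma> = \<gamma>' \<and> c = c'"
    proof (cases "sink \<alpha>")
      case True
      then have "\<not> (\<exists>e\<in>arcs \<Gamma>. tail \<Gamma> e = \<alpha>)" by (auto simp: sink_def)
      then show ?thesis
        using descends_to_sink_cases[OF \<gamma>(2,1)] descends_to_sink_cases[OF \<gamma>'(2,1)] by blast
    next
      case False
      obtain e d where e: "e \<in> arcs \<Gamma>" "tail \<Gamma> e = \<alpha>" "descends S (head \<Gamma> e) \<gamma> d" "c = sgn_weight e * d"
        using descends_to_sink_cases[OF \<gamma>(2,1)] False by blast
      obtain e' d' where e': "e' \<in> arcs \<Gamma>" "tail \<Gamma> e' = \<alpha>" "descends S (head \<Gamma> e') \<gamma>' d'"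
        "c' = sgn_weight e' * d'"
        using descends_to_sink_cases[OF \<gamma>'(2,1)] False by blast
      have "n (label \<Gamma> e) (label \<Gamma> e') < \<infinity>" using n_fin e(1) e'(1) by simp
      then obtain \<delta> a a' where \<delta>: "descends S (head \<Gamma> e) \<delta> a" "descends S (head \<Gamma> e') \<delta> a'"
        "sgn_weight e * a = sgn_weight e' * a'"
        using local_confluence[OF e(1) e'(1)] unfolding e(2) e'(2) by blast
      have "head \<Gamma> e \<in> \<Union>acyclic_classes" using \<alpha> acyclic_classes_closed[OF e(1)] e(2) by simp
      then obtain \<epsilon> b where \<epsilon>: "sink \<epsilon>" "descends S \<delta> \<epsilon> b"
        using ex_sink[OF fin descends_closed[OF \<delta>(1)]] by blast
      have "\<gamma> = \<epsilon> \<and> d = a * b"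
        using IH[OF e(1,2)] \<gamma>(1) e(3) \<epsilon>(1) descends_trans[OF \<delta>(1) \<epsilon>(2)] by blast
      moreover have "\<gamma>' = \<epsilon> \<and> d' = a' * b"
        using IH[OF e'(1,2)] \<gamma>'(1) e'(3) \<epsilon>(1) descends_trans[OF \<delta>(2) \<epsilon>(2)] by blast
      ultimately show ?thesis using e(4) e'(4) \<delta>(3) by (simp flip: mult.assoc)
    qed
  qed
  then show ?thesis using sinks by blast
qed

text \<open>
  The required solution assigns to a vertex the product of the weights along any descent to its
  sink.
\<close>

lemma dim_sgn_vectors:
  assumes fin: "finite (verts \<Gamma>)" and n_fin: "\<forall>s\<in>S. \<forall>t\<in>S. n s t < \<infinity>"
  shows "Qu.dim sgn_vectors = card acyclic_classes"
proof -
  define f where "f \<alpha> = (SOME c. \<exists>\<gamma>. sink \<gamma> \<and> descends S \<alpha> \<gamma> c)" for \<alpha>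
  have f: "\<exists>\<gamma>. sink \<gamma> \<and> descends S \<alpha> \<gamma> (f \<alpha>)" if "\<alpha> \<in> \<Union>acyclic_classes" for \<alpha>
    unfolding f_def by (rule someI_ex) (use ex_sink[OF fin that] in blast)
  show ?thesis
  proof (rule dim_sgn_vectors_of_potential[OF fin])
    show "f x \<noteq> 0" if "x \<in> \<Union>acyclic_classes" for x
      using f[OF that] descends_neq_0 by blast
    show "f (tail \<Gamma> e) = sgn_weight e * f (head \<Gamma> e)"
      if e: "e \<in> arcs \<Gamma>" "tail \<Gamma> e \<in> \<Union>acyclic_classes" for e
    proof -
      obtain \<gamma> where \<gamma>: "sink \<gamma>" "descends S (head \<Gamma> e) \<gamma> (f (head \<Gamma> e))"
        using f acyclic_classes_closed[OF e(1)] e(2) by blast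
      obtain \<gamma>' where \<gamma>': "sink \<gamma>'" "descends S (tail \<Gamma> e) \<gamma>' (f (tail \<Gamma> e))"
        using f[OF e(2)] by blast
      show ?thesis
        using unique_sink[OF fin n_fin e(2) \<gamma>'(1) \<gamma>(1) \<gamma>'(2) descends.step[OF e(1) _ \<gamma>(2)]] e(1) by simp
    qed
  qed
qed

end

theorem theorem1p7:
  fixes W :: "'w monoid" and S :: "'w set" and n :: "'w \<Rightarrow> 'w \<Rightarrow> enat"
    and H :: "('w \<Rightarrow>\<^sub>0 Qu) ring"
    and \<Gamma> :: "('v, 'e, 'w) labeled_digraph"
  assumes "coxeter_system W S n"
    and "hecke_algebra W S n H"
    and "W_digraph S H \<Gamma>"
    and "finite (verts \<Gamma>)"
  shows "card (components (underlying \<Gamma>)) =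
           vector_space.dim scale (weight_space S H \<Gamma> (ind_char W S)) \<and>
     ((\<forall>s\<in>S. \<forall>t\<in>S. n s t < \<infinity>) \<longrightarrow>
         card {C \<in> components (underlying \<Gamma>). acyclic_digraph C} =
           vector_space.dim scale (weight_space S H \<Gamma> (sgn_char W S)))"
proof -
  have "is_tau_hom S H \<Gamma> (action S H \<Gamma>)"
    using assms(3) someI_ex[of "is_tau_hom S H \<Gamma>"] unfolding action_def W_digraph_def by blast
  moreover have "S_labeled_digraph S \<Gamma>" using assms(3) by (simp add: W_digraph_def)
  ultimately interpret W_digraph_module W S n H \<Gamma> "action S H \<Gamma>"
    using assms(2)
    by (intro W_digraph_module.intro edge_labeled_digraph.intro W_digraph_module_axioms.intro)
  have weights: "weight_space S H \<Gamma> (lin_form (\<lambda>w. c ^ len w)) = {v \<in> MM \<Gamma>. \<forall>s\<in>S. tau \<Gamma> s v = scale c v}" for c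
    unfolding weight_space_def using weight_space_iff_generators by blast
  have "weight_space S H \<Gamma> (ind_char W S) = ind_vectors"
    unfolding ind_char_def power_mult weights by (rule ind_vectors_eq_eigenspace)
  moreover have "weight_space S H \<Gamma> (sgn_char W S) = sgn_vectors"
    unfolding sgn_char_def weights by (rule sgn_vectors_eq_eigenspace)
  ultimately show ?thesis
    using dim_ind_vectors dim_sgn_vectors card_components card_acyclic_components assms(4) by simp
qed

end
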